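(* Let $G$ be a simple connected positively LLY-curved $C_4$-free graph with minimum degree $\delta(G)\geq 2$. Then $G\cong C_3$, $G\cong C_5$, $G\cong T$, $G\cong H$, or $G\cong F_k$ for some $k\in\{2,3\}$.
   Context: Graphs are undirected and simple, and every vertex has finite degree. For a graph $G=(V,E)$, $d_v$ is the degree of $v$, $N(v)$ its neighborhood, $d(u,v)$ the graph distance (number of edges in a shortest path), $\delta(G)$ the minimum degree. $G$ is $F$-free if it contains no copy of $F$ as a (not necessarily induced) subgraph; $C_n$ is the cycle on $n$ vertices. Named graphs: $F_k$ is the friendship graph obtained from $k$ triangles by sharing one common vertex (so $2k+1$ vertices). $T$ is the graph on 7 vertices obtained from the disjoint union of a triangle $a_1a_2a_3$ and a star $K_{1,3}$ with center $c$ and leaves $b_1,b_2,b_3$ by adding the three matching edges $a_1b_1,a_2b_2,a_3b_3$. $H$ is the line graph of the Petersen graph (15 vertices, 4-regular). Lin-Lu-Yau (LLY) curvature: for a vertex $x$ and $0\le\alpha<1$, let $m_x^\alpha$ be the probability distribution on $V$ with $m_x^\alpha(x)=\alpha$, $m_x^\alpha(v)=(1-\alpha)/d_x$ for $v\in N(x)$, and $m_x^\alpha(v)=0$ otherwise. For finitely supported probability distributions $m_1,m_2$ on $V$, a coupling is a finitely supported map $A:V\times V\to[0,1]$ with $\sum_{y}A(x,y)=m_1(x)$ and $\sum_x A(x,y)=m_2(y)$, and $W(m_1,m_2)=\inf_A\sum_{x,y\in V}A(x,y)d(x,y)$ over all couplings $A$. For $x\ne y$ put $\kappa_\alpha(x,y)=1-\frac{W(m_x^\alpha,m_y^\alpha)}{d(x,y)}$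 and $\kappa_{\mathrm{LLY}}(x,y)=\lim_{\alpha\to1}\frac{\kappa_\alpha(x,y)}{1-\alpha}$ (the limit as $\alpha\to 1^-$, which exists). $G$ is positively LLY-curved if $\kappa_{\mathrm{LLY}}(x,y)>0$ for every edge $xy\in E$ (for connected graphs this is equivalent to positivity for every pair of distinct vertices). *)

theory Defs
  imports Complex_Main
begin

section \<open>Simple graphs\<close>

text \<open>
  The digraphs of the AFP entry Graph_Theory are arc-based, and their undirected specialisation
  (locale \<open>graph\<close>) is finite. Here graphs may be infinite, and edges are two-element vertex sets.
\<close>

record 'a sgraph =
  verts :: "'a set"
  edges :: "'a set set"

definition simple_graph :: "'a sgraph \<Rightarrow> bool" where
  "simple_graph G \<longleftrightarrow> (\<forall>e\<in>edges G. e \<subseteq> verts G \<and> card e = 2)"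

definition neighborhood :: "'a sgraph \<Rightarrow> 'a \<Rightarrow> 'a set" where
  "neighborhood G v = {u \<in> verts G. {v, u} \<in> edges G}"

definition locally_finite_graph :: "'a sgraph \<Rightarrow> bool" where
  "locally_finite_graph G \<longleftrightarrow> (\<forall>v\<in>verts G. finite (neighborhood G v))"

definition degree :: "'a sgraph \<Rightarrow> 'a \<Rightarrow> nat" where
  "degree G v = card (neighborhood G v)"

definition min_degree :: "'a sgraph \<Rightarrow> nat" where
  "min_degree G = (INF v\<in>verts G. degree G v)"

definition is_path :: "'a sgraph \<Rightarrow> 'a \<Rightarrow> 'a list \<Rightarrow> 'a \<Rightarrow> bool" where
  "is_path G u p v \<longleftrightarrow> p \<noteq> [] \<and> hd p = u \<and> last p = v \<and> set p \<subseteq> verts G \<and> distinct p \<and>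
     successively (\<lambda>x y. {x, y} \<in> edges G) p"

definition connected_graph :: "'a sgraph \<Rightarrow> bool" where
  "connected_graph G \<longleftrightarrow> verts G \<noteq> {} \<and> (\<forall>u\<in>verts G. \<forall>v\<in>verts G. \<exists>p. is_path G u p v)"

text \<open>The value is arbitrary if no path joins \<open>u\<close> and \<open>v\<close>.\<close>

definition graph_dist :: "'a sgraph \<Rightarrow> 'a \<Rightarrow> 'a \<Rightarrow> nat" where
  "graph_dist G u v = (LEAST n. \<exists>p. is_path G u p v \<and> length p = n + 1)"

definition contains_copy :: "'a sgraph \<Rightarrow> 'b sgraph \<Rightarrow> bool" where
  "contains_copy G F \<longleftrightarrow>
     (\<exists>f. inj_on f (verts F) \<and> f ` verts F \<subseteq> verts G \<and> (\<forall>e\<in>edges F. f ` e \<in> edges G))"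

definition graph_free :: "'b sgraph \<Rightarrow> 'a sgraph \<Rightarrow> bool" where
  "graph_free F G \<longleftrightarrow> \<not> contains_copy G F"

definition isomorphic :: "'a sgraph \<Rightarrow> 'b sgraph \<Rightarrow> bool" where
  "isomorphic G F \<longleftrightarrow>
     (\<exists>f. bij_betw f (verts G) (verts F) \<and>
          (\<forall>u\<in>verts G. \<forall>v\<in>verts G. {u, v} \<in> edges G \<longleftrightarrow> {f u, f v} \<in> edges F))"

section \<open>Named graphs\<close>

text \<open>This is the cycle $C_n$ only for \<open>n \<ge> 3\<close>.\<close>

definition cycle_graph :: "nat \<Rightarrow> nat sgraph" where
  "cycle_graph n = \<lparr>verts = {0..<n}, edges = {{i, (i + 1) mod n} | i. i < n}\<rparr>"

text \<open>The common vertex of the triangles is \<open>0\<close>.\<close>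

definition friendship_graph :: "nat \<Rightarrow> nat sgraph" where
  "friendship_graph k =
     \<lparr>verts = {0..2 * k},
      edges = (\<Union>i<k. {{0, 2 * i + 1}, {0, 2 * i + 2}, {2 * i + 1, 2 * i + 2}})\<rparr>"

text \<open>
  The triangle $a_1 a_2 a_3$ is \<open>0, 1, 2\<close>, the leaves $b_1, b_2, b_3$ of the star are
  \<open>3, 4, 5\<close>, and its center $c$ is \<open>6\<close>.
\<close>

definition T_graph :: "nat sgraph" where
  "T_graph =
     \<lparr>verts = {0..6},
      edges = {{0, 1}, {1, 2}, {0, 2}} \<union> {{6, 3}, {6, 4}, {6, 5}} \<union> {{0, 3}, {1, 4}, {2, 5}}\<rparr>"

text \<open>The Petersen graph as the Kneser graph $K(5,2)$.\<close>

definition petersen_graph :: "nat set sgraph" where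
  "petersen_graph =
     (let P = {S. S \<subseteq> {0..<5} \<and> card S = 2}
      in \<lparr>verts = P, edges = {{S, S'} | S S'. S \<in> P \<and> S' \<in> P \<and> S \<inter> S' = {}}\<rparr>)"

definition line_graph :: "'a sgraph \<Rightarrow> 'a set sgraph" where
  "line_graph G =
     \<lparr>verts = edges G,
      edges = {{e, e'} | e e'. e \<in> edges G \<and> e' \<in> edges G \<and> e \<noteq> e' \<and> e \<inter> e' \<noteq> {}}\<rparr>"

definition H_graph :: "nat set set sgraph" where
  "H_graph = line_graph petersen_graph"

section \<open>Lin--Lu--Yau curvature\<close>

definition walk_measure :: "'a sgraph \<Rightarrow> real \<Rightarrow> 'a \<Rightarrow> 'a \<Rightarrow> real" where
  "walk_measure G \<alpha> x v =
     (if v = x then \<alpha>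
      else if v \<in> neighborhood G x then (1 - \<alpha>) / real (degree G x)
      else 0)"

text \<open>
  All sums below range over the support, since \<open>sum\<close> over an infinite set is \<open>0\<close>.
\<close>

definition is_coupling ::
  "'a sgraph \<Rightarrow> ('a \<Rightarrow> real) \<Rightarrow> ('a \<Rightarrow> real) \<Rightarrow> ('a \<times> 'a \<Rightarrow> real) \<Rightarrow> bool" where
  "is_coupling G m1 m2 A \<longleftrightarrow>
     finite {p. A p \<noteq> 0} \<and> {p. A p \<noteq> 0} \<subseteq> verts G \<times> verts G \<and>
     (\<forall>p. 0 \<le> A p \<and> A p \<le> 1) \<and>
     (\<forall>x\<in>verts G. (\<Sum>y\<in>{y. A (x, y) \<noteq> 0}. A (x, y)) = m1 x) \<and>
     (\<forall>y\<in>verts G. (\<Sum>x\<in>{x. A (x, y) \<noteq> 0}. A (x, y)) = m2 y)"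

definition transport_cost :: "'a sgraph \<Rightarrow> ('a \<times> 'a \<Rightarrow> real) \<Rightarrow> real" where
  "transport_cost G A = (\<Sum>(x, y)\<in>{p. A p \<noteq> 0}. A (x, y) * real (graph_dist G x y))"

definition wasserstein :: "'a sgraph \<Rightarrow> ('a \<Rightarrow> real) \<Rightarrow> ('a \<Rightarrow> real) \<Rightarrow> real" where
  "wasserstein G m1 m2 = (INF A\<in>{A. is_coupling G m1 m2 A}. transport_cost G A)"

definition kappa :: "'a sgraph \<Rightarrow> real \<Rightarrow> 'a \<Rightarrow> 'a \<Rightarrow> real" where
  "kappa G \<alpha> x y =
     1 - wasserstein G (walk_measure G \<alpha> x) (walk_measure G \<alpha> y) / real (graph_dist G x y)"

definition kappa_LLY :: "'a sgraph \<Rightarrow> 'a \<Rightarrow> 'a \<Rightarrow> real" where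
  "kappa_LLY G x y = Lim (at_left 1) (\<lambda>\<alpha>. kappa G \<alpha> x y / (1 - \<alpha>))"

definition positively_LLY_curved :: "'a sgraph \<Rightarrow> bool" where
  "positively_LLY_curved G \<longleftrightarrow>
     (\<forall>x\<in>verts G. \<forall>y\<in>verts G. {x, y} \<in> edges G \<longrightarrow> kappa_LLY G x y > 0)"

end

theory Submission
  imports Defs
begin

text \<open>
  Any pair of functions \<open>\<phi>, \<psi>\<close> with \<open>\<phi> u - \<psi> v \<le> d(u, v)\<close> on the two closed neighborhoods of an edge
  \<open>xy\<close>, tight at \<open>(x, y)\<close>, bounds the curvature of \<open>xy\<close> from above by weak Kantorovich duality.
  In a \<open>C\<^sub>4\<close>-free graph, neighbors \<open>u\<close> of \<open>x\<close> and \<open>v\<close> of \<open>y\<close> outside a common triangle have distance 2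
  or 3, so potentials with few values turn positive curvature into a degree inequality and into
  the requirement that such \<open>u\<close> and \<open>v\<close> often have a common neighbor (\<open>edge_condition\<close>).

  For an edge in no triangle the degrees are (2,2) or (2,3) and every such \<open>u, v\<close> closes a
  pentagon, which forces \<open>C\<^sub>5\<close> or \<open>T\<close>. Otherwise every neighborhood is a perfect matching and
  all degrees are 2, 4 or 6. A vertex of degree 2 or 6 forces a friendship graph. In the 4-regular
  case the graph is the line graph of a cubic graph of girth at least 5 whose vertices are the
  triangles; the matching condition closes a pentagon over every path of length 2, and this
  determines the Petersen graph.
\<close>

section \<open>Upper bounds for the curvature\<close>

lemma coupling_support:
  assumes "is_coupling G m1 m2 A"
  obtains S where "finite S" "S \<subseteq> verts G" "{p. A p \<noteq> 0} \<subseteq> S \<times> S"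
proof
  let ?S = "fst ` {p. A p \<noteq> 0} \<union> snd ` {p. A p \<noteq> 0}"
  have A: "finite {p. A p \<noteq> 0}" "{p. A p \<noteq> 0} \<subseteq> verts G \<times> verts G"
    using assms by (simp_all add: is_coupling_def)
  then show "finite ?S" by simp
  show "?S \<subseteq> verts G" using A(2) by fastforce
  show "{p. A p \<noteq> 0} \<subseteq> ?S \<times> ?S" by (auto simp: image_iff)
qed

text \<open>With one finite carrier \<open>S\<close> for both coordinates, all marginals are sums
  over the same index set, so they can be added, swapped and rescaled.\<close>

lemma is_coupling_iff:
  assumes S: "finite S" "S \<subseteq> verts G" "{p. A p \<noteq> 0} \<subseteq> S \<times> S"
  shows "is_coupling G m1 m2 A \<longleftrightarrow>
     (\<forall>p. 0 \<le> A p \<and> A p \<le> 1) \<and>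
     (\<forall>x\<in>verts G. (\<Sum>y\<in>S. A (x, y)) = m1 x) \<and>
     (\<forall>y\<in>verts G. (\<Sum>x\<in>S. A (x, y)) = m2 y)"
proof -
  have "finite {p. A p \<noteq> 0}" "{p. A p \<noteq> 0} \<subseteq> verts G \<times> verts G"
    using finite_subset[OF S(3)] S by auto
  moreover have "(\<Sum>y\<in>{y. A (x, y) \<noteq> 0}. A (x, y)) = (\<Sum>y\<in>S. A (x, y))" for x
    using S by (intro sum.mono_neutral_left) auto
  moreover have "(\<Sum>x\<in>{x. A (x, y) \<noteq> 0}. A (x, y)) = (\<Sum>x\<in>S. A (x, y))" for y
    using S by (intro sum.mono_neutral_left) auto
  ultimately show ?thesis by (simp add: is_coupling_def)
qed

lemma transport_cost_eq:
  assumes S: "finite S" "{p. A p \<noteq> 0} \<subseteq> S \<times> S"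
  shows "transport_cost G A = (\<Sum>x\<in>S. \<Sum>y\<in>S. A (x, y) * real (graph_dist G x y))"
proof -
  have "transport_cost G A = (\<Sum>(x, y)\<in>S \<times> S. A (x, y) * real (graph_dist G x y))"
    unfolding transport_cost_def using S by (intro sum.mono_neutral_left) auto
  then show ?thesis by (simp add: sum.cartesian_product)
qed

lemma transport_cost_nonneg:
  assumes "is_coupling G m1 m2 A"
  shows "transport_cost G A \<ge> 0"
  unfolding transport_cost_def using assms
  by (intro sum_nonneg) (auto simp: is_coupling_def)

lemma wasserstein_le:
  assumes "is_coupling G m1 m2 A"
  shows "wasserstein G m1 m2 \<le> transport_cost G A"
  unfolding wasserstein_def using assms
  by (intro cINF_lower bdd_belowI2[where m = 0]) (auto intro: transport_cost_nonneg)

text \<open>By the marginal conditions the left side is the integral of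
  \<open>\<phi> u - \<psi> v\<close> against \<open>A\<close>. The distance bound on
  \<open>U \<times> V\<close> suffices because \<open>A\<close> vanishes elsewhere.\<close>

lemma duality_le_transport_cost:
  fixes \<phi> \<psi> :: "'a \<Rightarrow> real"
  assumes A: "is_coupling G m1 m2 A"
    and U: "finite U" "U \<subseteq> verts G" "\<And>u. u \<in> verts G \<Longrightarrow> u \<notin> U \<Longrightarrow> m1 u = 0"
    and V: "finite V" "V \<subseteq> verts G" "\<And>v. v \<in> verts G \<Longrightarrow> v \<notin> V \<Longrightarrow> m2 v = 0"
    and lip: "\<And>u v. u \<in> U \<Longrightarrow> v \<in> V \<Longrightarrow> \<phi> u - \<psi> v \<le> real (graph_dist G u v)"
  shows "(\<Sum>u\<in>U. \<phi> u * m1 u) - (\<Sum>v\<in>V. \<psi> v * m2 v) \<le> transport_cost G A"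
proof -
  obtain S where S: "finite S" "S \<subseteq> verts G" "{p. A p \<noteq> 0} \<subseteq> S \<times> S"
    using coupling_support[OF A] by blast
  note c = A[unfolded is_coupling_iff[OF S]]
  \<comment> \<open>A row or column of nonnegative entries whose marginal is zero consists of
    zeros.\<close>
  have zero: "A (u, v) = 0" if "u \<in> S" "v \<in> S" "u \<notin> U \<or> v \<notin> V" for u v
  proof (cases "u \<in> U")
    case False
    with that S U have "(\<Sum>y\<in>S. A (u, y)) = 0" using c by auto
    then show ?thesis using sum_nonneg_eq_0_iff[OF S(1), of "\<lambda>y. A (u, y)"] c that by auto
  next
    case True
    with that S V have "(\<Sum>x\<in>S. A (x, v)) = 0" using c by auto
    then show ?thesis using sum_nonneg_eq_0_iff[OF S(1), of "\<lambda>x. A (x, v)"] c that by auto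
  qed
  \<comment> \<open>Conversely, a vertex outside \<open>S\<close> has an empty row, so the sums over
    \<open>U\<close> and over \<open>S\<close> both reduce to \<open>U \<inter> S\<close>.\<close>
  have m1: "m1 u = 0" if "u \<in> verts G" "u \<notin> S" for u
  proof -
    have "(\<Sum>y\<in>S. A (u, y)) = 0" using S that by (intro sum.neutral) auto
    then show ?thesis using c that by auto
  qed
  have m2: "m2 v = 0" if "v \<in> verts G" "v \<notin> S" for v
  proof -
    have "(\<Sum>x\<in>S. A (x, v)) = 0" using S that by (intro sum.neutral) auto
    then show ?thesis using c that by auto
  qed
  have "(\<Sum>u\<in>U. \<phi> u * m1 u) = (\<Sum>u\<in>U \<inter> S. \<phi> u * m1 u)"
    using U m1 by (intro sum.mono_neutral_right) auto
  also have "\<dots> = (\<Sum>u\<in>S. \<phi> u * m1 u)"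
    using S U by (intro sum.mono_neutral_left) auto
  also have "\<dots> = (\<Sum>u\<in>S. \<Sum>v\<in>S. \<phi> u * A (u, v))"
    using c S(2) by (intro sum.cong) (auto simp: sum_distrib_left[symmetric])
  finally have 1: "(\<Sum>u\<in>U. \<phi> u * m1 u) = (\<Sum>u\<in>S. \<Sum>v\<in>S. \<phi> u * A (u, v))" .
  have "(\<Sum>v\<in>V. \<psi> v * m2 v) = (\<Sum>v\<in>V \<inter> S. \<psi> v * m2 v)"
    using V m2 by (intro sum.mono_neutral_right) auto
  also have "\<dots> = (\<Sum>v\<in>S. \<psi> v * m2 v)"
    using S V by (intro sum.mono_neutral_left) auto
  also have "\<dots> = (\<Sum>v\<in>S. \<Sum>u\<in>S. \<psi> v * A (u, v))"
    using c S(2) by (intro sum.cong) (auto simp: sum_distrib_left[symmetric])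
  also have "\<dots> = (\<Sum>u\<in>S. \<Sum>v\<in>S. \<psi> v * A (u, v))" by (rule sum.swap)
  finally have 2: "(\<Sum>v\<in>V. \<psi> v * m2 v) = (\<Sum>u\<in>S. \<Sum>v\<in>S. \<psi> v * A (u, v))" .
  have "\<phi> u * A (u, v) - \<psi> v * A (u, v) \<le> A (u, v) * real (graph_dist G u v)"
    if "u \<in> S" "v \<in> S" for u v
  proof (cases "u \<in> U \<and> v \<in> V")
    case True
    then have "A (u, v) * (\<phi> u - \<psi> v) \<le> A (u, v) * real (graph_dist G u v)"
      using c lip by (intro mult_left_mono) auto
    then show ?thesis by (simp add: algebra_simps)
  next
    case False
    then show ?thesis using zero[OF that] by auto
  qed
  then show ?thesis
    unfolding 1 2 transport_cost_eq[OF S(1,3)] sum_subtractf[symmetric]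
    by (intro sum_mono) auto
qed

text \<open>The product measure is a coupling. An infimum over an empty set of couplings would carry
  no information, so existence is needed before \<open>wasserstein\<close> can be bounded from
  below.\<close>

lemma coupling_exists:
  assumes U: "finite U" "U \<subseteq> verts G" "\<And>u. u \<notin> U \<Longrightarrow> m1 u = 0"
    and V: "finite V" "V \<subseteq> verts G" "\<And>v. v \<notin> V \<Longrightarrow> m2 v = 0"
    and nn: "\<And>u. 0 \<le> m1 u" "\<And>v. 0 \<le> m2 v"
    and one: "sum m1 U = 1" "sum m2 V = 1"
  shows "\<exists>A. is_coupling G m1 m2 A"
proof -
  let ?A = "\<lambda>(u, v). m1 u * m2 v" and ?S = "U \<union> V"
  have S: "finite ?S" "?S \<subseteq> verts G"
    using U(1,2) V(1,2) by simp_all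
  have SA: "{p. ?A p \<noteq> 0} \<subseteq> ?S \<times> ?S"
  proof safe
    fix u v assume "m1 u * m2 v \<noteq> 0"
    then have "m1 u \<noteq> 0" "m2 v \<noteq> 0" by simp_all
    then show "u \<in> U" if "u \<notin> V" using U(3) by metis
    from \<open>m1 u \<noteq> 0\<close> \<open>m2 v \<noteq> 0\<close> show "v \<in> U" if "v \<notin> V" using V(3) that by metis
  qed
  have s1: "sum m1 ?S = 1"
    using U(3) S one(1) sum.mono_neutral_right[of ?S U m1] by simp
  have s2: "sum m2 ?S = 1"
    using V(3) S one(2) sum.mono_neutral_right[of ?S V m2] by simp
  have le1: "m1 u \<le> 1" for u
    using member_le_sum[of u U m1] nn(1) U(1) U(3)[of u] one(1) by (cases "u \<in> U") simp_all
  have le2: "m2 u \<le> 1" for u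
    using member_le_sum[of u V m2] nn(2) V(1) V(3)[of u] one(2) by (cases "u \<in> V") simp_all
  have "is_coupling G m1 m2 ?A"
    unfolding is_coupling_iff[OF S SA]
  proof (intro conjI allI ballI)
    fix p
    show "0 \<le> ?A p" "?A p \<le> 1"
      by (simp_all add: case_prod_unfold mult_le_one nn le1 le2)
  next
    fix v
    show "(\<Sum>y\<in>?S. ?A (v, y)) = m1 v" "(\<Sum>x\<in>?S. ?A (x, v)) = m2 v"
      by (simp_all add: s1 s2 flip: sum_distrib_left sum_distrib_right)
  qed
  then show ?thesis by blast
qed

section \<open>Lazy walk measures\<close>

lemma finite_neighborhood:
  "locally_finite_graph G \<Longrightarrow> v \<in> verts G \<Longrightarrow> finite (neighborhood G v)"
  by (simp add: locally_finite_graph_def)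

lemma neighborhood_subset: "u \<in> neighborhood G v \<Longrightarrow> u \<in> verts G"
  by (auto simp: neighborhood_def)

lemma self_notin_neighborhood:
  "simple_graph G \<Longrightarrow> v \<notin> neighborhood G v"
  by (auto simp: neighborhood_def simple_graph_def)

lemma sum_walk_measure:
  fixes f :: "'a \<Rightarrow> real"
  assumes "simple_graph G" "locally_finite_graph G" "x \<in> verts G"
  shows "(\<Sum>v\<in>insert x (neighborhood G x). f v * walk_measure G \<alpha> x v) =
    \<alpha> * f x + (1 - \<alpha>) * ((\<Sum>v\<in>neighborhood G x. f v) / degree G x)"
proof -
  have "(\<Sum>v\<in>neighborhood G x. f v * walk_measure G \<alpha> x v) =
     (\<Sum>v\<in>neighborhood G x. f v * ((1 - \<alpha>) / degree G x))"
    using self_notin_neighborhood[OF assms(1)]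
    by (intro sum.cong) (auto simp: walk_measure_def)
  also have "\<dots> = (1 - \<alpha>) * ((\<Sum>v\<in>neighborhood G x. f v) / degree G x)"
    by (simp add: sum_distrib_left sum_divide_distrib mult_ac)
  finally show ?thesis
    using finite_neighborhood[OF assms(2,3)] self_notin_neighborhood[OF assms(1), of x]
    by (simp add: walk_measure_def)
qed

lemma walk_coupling_exists:
  assumes "simple_graph G" "locally_finite_graph G" "x \<in> verts G" "y \<in> verts G"
    and "degree G x > 0" "degree G y > 0" "0 < \<alpha>" "\<alpha> < 1"
  shows "\<exists>A. is_coupling G (walk_measure G \<alpha> x) (walk_measure G \<alpha> y) A"
proof (rule coupling_exists)
  have one: "sum (walk_measure G \<alpha> v) (insert v (neighborhood G v)) = 1"
    if "v \<in> verts G" "degree G v > 0" for v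
    using sum_walk_measure[OF assms(1,2) that(1), of "\<lambda>_. 1" \<alpha>] that
    by (simp add: degree_def)
  show "sum (walk_measure G \<alpha> x) (insert x (neighborhood G x)) = 1"
    "sum (walk_measure G \<alpha> y) (insert y (neighborhood G y)) = 1"
    using assms by (auto intro: one)
qed (use assms in
      \<open>auto simp: neighborhood_subset walk_measure_def finite_neighborhood\<close>)

text \<open>Laziness can be increased by mixing a coupling with the point mass at \<open>(x, y)\<close>.\<close>

lemma lazy_coupling:
  assumes A: "is_coupling G (walk_measure G \<alpha> x) (walk_measure G \<alpha> y) A"
    and xy: "x \<in> verts G" "y \<in> verts G" and t: "0 \<le> t" "t \<le> 1"
    and \<beta>: "1 - \<beta> = (1 - t) * (1 - \<alpha>)"
  defines "B \<equiv> \<lambda>p. (1 - t) * A p + (if p = (x, y) then t else 0)"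
  shows "is_coupling G (walk_measure G \<beta> x) (walk_measure G \<beta> y) B"
    and "transport_cost G B = (1 - t) * transport_cost G A + t * graph_dist G x y"
proof -
  obtain S0 where S0: "finite S0" "S0 \<subseteq> verts G" "{p. A p \<noteq> 0} \<subseteq> S0 \<times> S0"
    using coupling_support[OF A] by blast
  define S where "S = insert x (insert y S0)"
  have S: "finite S" "S \<subseteq> verts G" "{p. A p \<noteq> 0} \<subseteq> S \<times> S"
    using S0 xy unfolding S_def by auto
  have SB: "{p. B p \<noteq> 0} \<subseteq> S \<times> S"
    using S by (auto simp: B_def S_def)
  note c = A[unfolded is_coupling_iff[OF S]]
  have B1: "0 \<le> B p \<and> B p \<le> 1" for p
  proof -
    have "(1 - t) * A p \<le> 1 - t" "0 \<le> (1 - t) * A p"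
      using c[THEN conjunct1, rule_format, of p] t by (auto intro: mult_left_le)
    then show ?thesis using t by (auto simp: B_def)
  qed
  \<comment> \<open>Here the relation between the two laziness parameters enters: the lazier walk is
    a mixture of the old one with the point mass at its base vertex.\<close>
  have w: "walk_measure G \<beta> v u = (1 - t) * walk_measure G \<alpha> v u + (if u = v then t else 0)"
    for u v
  proof -
    have "\<beta> = (1 - t) * \<alpha> + t" using \<beta> by (simp add: algebra_simps)
    then show ?thesis using \<beta> by (simp add: walk_measure_def)
  qed
  have xS: "x \<in> S" "y \<in> S" by (auto simp: S_def)
  have "(\<Sum>v\<in>S. B (u, v)) = walk_measure G \<beta> x u" if "u \<in> verts G" for u
  proof -
    have "(\<Sum>v\<in>S. B (u, v)) = (1 - t) * (\<Sum>v\<in>S. A (u, v)) + (if u = x then t else 0)"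
      using S xS by (auto simp: B_def sum.distrib sum_distrib_left)
    then show ?thesis using c that by (simp add: w)
  qed
  moreover have "(\<Sum>u\<in>S. B (u, v)) = walk_measure G \<beta> y v" if "v \<in> verts G" for v
  proof -
    have "(\<Sum>u\<in>S. B (u, v)) = (1 - t) * (\<Sum>u\<in>S. A (u, v)) + (if v = y then t else 0)"
      using S xS by (auto simp: B_def sum.distrib sum_distrib_left)
    then show ?thesis using c that by (simp add: w)
  qed
  ultimately show "is_coupling G (walk_measure G \<beta> x) (walk_measure G \<beta> y) B"
    unfolding is_coupling_iff[OF S(1,2) SB] using B1 by blast
  have "transport_cost G B = (\<Sum>(u, v)\<in>S \<times> S. B (u, v) * graph_dist G u v)"
    unfolding transport_cost_eq[OF S(1) SB] by (simp add: sum.cartesian_product)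
  also have "\<dots> = (\<Sum>(u, v)\<in>S \<times> S. (1 - t) * (A (u, v) * graph_dist G u v) +
      (if (u, v) = (x, y) then t * graph_dist G u v else 0))"
    by (intro sum.cong) (auto simp: B_def algebra_simps)
  also have "\<dots> = (1 - t) * (\<Sum>(u, v)\<in>S \<times> S. A (u, v) * graph_dist G u v) +
      (\<Sum>p\<in>S \<times> S. if p = (x, y) then t * graph_dist G (fst p) (snd p) else 0)"
    by (auto simp: case_prod_unfold sum.distrib sum_distrib_left intro!: sum.cong)
  also have "\<dots> = (1 - t) * transport_cost G A + t * graph_dist G x y"
    using S xS by (simp add: transport_cost_eq[OF S(1,3)] sum.cartesian_product)
  finally show "transport_cost G B = (1 - t) * transport_cost G A + t * graph_dist G x y" .
qed

text \<open>The limit is the supremum of the values on the interval.\<close>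

lemma mono_tendsto_at_left:
  fixes h :: "real \<Rightarrow> real"
  assumes mono: "\<And>s t. a < s \<Longrightarrow> s \<le> t \<Longrightarrow> t < b \<Longrightarrow> h s \<le> h t"
    and bound: "\<And>s. a < s \<Longrightarrow> s < b \<Longrightarrow> h s \<le> c" and "a < b"
  shows "\<exists>l\<le>c. (h \<longlongrightarrow> l) (at_left b)"
proof (intro exI conjI order_tendstoI)
  let ?l = "SUP s\<in>{a<..<b}. h s"
  have ne: "{a<..<b} \<noteq> {}" using \<open>a < b\<close> by simp
  have bdd: "bdd_above (h ` {a<..<b})" using bound by (auto intro!: bdd_aboveI2)
  show "?l \<le> c" using bound ne by (intro cSUP_least) auto
  fix d
  have near: "eventually (\<lambda>s. s \<in> {a<..<b}) (at_left b)"
    using \<open>a < b\<close> by (simp add: eventually_at_left_field) blast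
  {
    assume "?l < d"
    then have "h s < d" if "s \<in> {a<..<b}" for s
      using cSUP_upper[OF that bdd] by simp
    with near show "eventually (\<lambda>s. h s < d) (at_left b)"
      by (auto elim: eventually_mono)
  next
    assume "d < ?l"
    then obtain s where s: "s \<in> {a<..<b}" "d < h s"
      using less_cSUP_iff[OF ne bdd] by auto
    have "d < h t" if "s < t" "t < b" for t
      using mono[of s t] s that by auto
    then show "eventually (\<lambda>t. d < h t) (at_left b)"
      using s by (auto simp: eventually_at_left_field intro!: bexI[of _ s])
  }
qed

text \<open>Write \<open>D\<close> for the difference of the two means. Duality gives
  \<open>\<alpha> + (1 - \<alpha>) * D\<close> as a lower bound for the Wasserstein distance;
  tightness at \<open>(x, y)\<close> makes the first term exactly \<open>\<alpha>\<close>. So every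
  quotient is at most \<open>1 - D\<close>, and hence so is its limit.\<close>

lemma kappa_LLY_le:
  fixes \<phi> \<psi> :: "'a \<Rightarrow> real"
  assumes G: "simple_graph G" "locally_finite_graph G"
    and xy: "x \<in> verts G" "y \<in> verts G" "degree G x > 0" "degree G y > 0" "graph_dist G x y = 1"
    and lip: "\<And>u v. u \<in> insert x (neighborhood G x) \<Longrightarrow> v \<in> insert y (neighborhood G y) \<Longrightarrow>
        \<phi> u - \<psi> v \<le> real (graph_dist G u v)"
    and tight: "\<phi> x - \<psi> y = 1"
  shows "kappa_LLY G x y \<le>
    1 - ((\<Sum>v\<in>neighborhood G x. \<phi> v) / degree G x - (\<Sum>v\<in>neighborhood G y. \<psi> v) / degree G y)"
proof -
  define D where "D = (\<Sum>v\<in>neighborhood G x. \<phi> v) / degree G x -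
    (\<Sum>v\<in>neighborhood G y. \<psi> v) / degree G y"
  define h where "h = (\<lambda>\<alpha>. kappa G \<alpha> x y / (1 - \<alpha>))"
  let ?W = "\<lambda>\<alpha>. wasserstein G (walk_measure G \<alpha> x) (walk_measure G \<alpha> y)"
  have k: "kappa G \<alpha> x y = 1 - ?W \<alpha>" for \<alpha>
    by (simp add: kappa_def xy)
  have bound: "h \<alpha> \<le> 1 - D" if \<alpha>: "0 < \<alpha>" "\<alpha> < 1" for \<alpha>
  proof -
    have "\<alpha> + (1 - \<alpha>) * D \<le> transport_cost G A"
      if "is_coupling G (walk_measure G \<alpha> x) (walk_measure G \<alpha> y) A" for A
    proof -
      have "\<alpha> + (1 - \<alpha>) * D =
        (\<Sum>v\<in>insert x (neighborhood G x). \<phi> v * walk_measure G \<alpha> x v) -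
        (\<Sum>v\<in>insert y (neighborhood G y). \<psi> v * walk_measure G \<alpha> y v)"
        unfolding sum_walk_measure[OF G xy(1)] sum_walk_measure[OF G xy(2)] D_def
        using arg_cong[OF tight, of "(*) \<alpha>"] by (simp add: right_diff_distrib)
      also have "\<dots> \<le> transport_cost G A"
        by (rule duality_le_transport_cost[OF that _ _ _ _ _ _ lip])
          (use xy G in \<open>auto simp: neighborhood_subset walk_measure_def finite_neighborhood\<close>)
      finally show ?thesis .
    qed
    then have "\<alpha> + (1 - \<alpha>) * D \<le> ?W \<alpha>"
      unfolding wasserstein_def using walk_coupling_exists[OF G xy(1-4) \<alpha>]
      by (intro cINF_greatest) auto
    then have "1 - ?W \<alpha> \<le> (1 - D) * (1 - \<alpha>)"
      by (simp add: algebra_simps)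
    then show ?thesis using \<alpha> by (simp add: h_def k pos_divide_le_eq)
  qed
  \<comment> \<open>Monotonicity in the laziness guarantees that the limit exists; otherwise
    \<open>Lim\<close> would be an unspecified value.\<close>
  have mono: "h \<alpha> \<le> h \<beta>" if \<alpha>: "0 < \<alpha>" "\<alpha> \<le> \<beta>" "\<beta> < 1" for \<alpha> \<beta>
  proof -
    \<comment> \<open>The share of the coupling that is kept when the laziness grows from
      \<open>\<alpha>\<close> to \<open>\<beta>\<close>. The remaining mass \<open>1 - s\<close>
      moves from \<open>x\<close> to \<open>y\<close> at distance 1.\<close>
    define s where "s = (1 - \<beta>) / (1 - \<alpha>)"
    have s: "0 < s" "s \<le> 1" "1 - \<beta> = (1 - (1 - s)) * (1 - \<alpha>)"
      using \<alpha> by (auto simp: s_def field_simps)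
    have "(?W \<beta> - (1 - s)) / s \<le> transport_cost G A"
      if A: "is_coupling G (walk_measure G \<alpha> x) (walk_measure G \<alpha> y) A" for A
    proof -
      note B = lazy_coupling[OF A xy(1,2) _ _ s(3)]
      have "?W \<beta> \<le> s * transport_cost G A + (1 - s)"
        using wasserstein_le[OF B(1)] B(2) s xy(5) by simp
      then show ?thesis using s(1) by (simp add: pos_divide_le_eq mult.commute)
    qed
    then have "(?W \<beta> - (1 - s)) / s \<le> ?W \<alpha>"
      unfolding wasserstein_def[of G "walk_measure G \<alpha> x"]
      using walk_coupling_exists[OF G xy(1-4), of \<alpha>] \<alpha>
      by (intro cINF_greatest) auto
    then have "s * (1 - ?W \<alpha>) \<le> 1 - ?W \<beta>"
      using s(1) by (simp add: pos_divide_le_eq algebra_simps)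
    then have "s * (1 - ?W \<alpha>) / (1 - \<beta>) \<le> (1 - ?W \<beta>) / (1 - \<beta>)"
      using \<alpha> by (intro divide_right_mono) auto
    moreover have "s * (1 - ?W \<alpha>) / (1 - \<beta>) = (1 - ?W \<alpha>) / (1 - \<alpha>)"
      using \<alpha> by (simp add: s_def)
    ultimately show ?thesis by (simp add: h_def k)
  qed
  obtain l where "l \<le> 1 - D" "(h \<longlongrightarrow> l) (at_left 1)"
    using mono_tendsto_at_left[of 0 1 h "1 - D"] mono bound by auto
  moreover from this have "kappa_LLY G x y = l"
    unfolding kappa_LLY_def h_def by (intro tendsto_Lim) auto
  ultimately show ?thesis by (simp add: D_def)
qed

section \<open>Positively curved $C_4$-free graphs\<close>

lemma is_path_short:
  assumes "is_path G u p v"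
  shows "length p = 1 \<Longrightarrow> u = v"
    and "length p = 2 \<Longrightarrow> {u, v} \<in> edges G"
    and "length p = 3 \<Longrightarrow> \<exists>w. {u, w} \<in> edges G \<and> {v, w} \<in> edges G"
  using assms by (auto simp: is_path_def length_Suc_conv eval_nat_numeral insert_commute)

lemma contains_C4I:
  assumes "{p, x} \<in> edges G" "{p, y} \<in> edges G" "{q, x} \<in> edges G" "{q, y} \<in> edges G"
    and "p \<in> verts G" "q \<in> verts G" "x \<in> verts G" "y \<in> verts G"
    and neq: "p \<noteq> q" "p \<noteq> x" "p \<noteq> y" "q \<noteq> x" "q \<noteq> y" "x \<noteq> y"
  shows "contains_copy G (cycle_graph 4)"
  unfolding contains_copy_def
proof (intro exI conjI)
  \<comment> \<open>The cycle runs through \<open>p\<close>, \<open>x\<close>, \<open>q\<close>,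
    \<open>y\<close> in this order, so \<open>p\<close> and \<open>q\<close> are opposite.\<close>
  let ?f = "\<lambda>i. [p, x, q, y] ! i"
  have i4: "i = 0 \<or> i = 1 \<or> i = 2 \<or> i = 3" if "i < 4" for i :: nat
    using that by linarith
  have m4: "(0 + 1) mod 4 = (1 :: nat)" "(1 + 1) mod 4 = (2 :: nat)"
    "(2 + 1) mod 4 = (3 :: nat)" "(3 + 1) mod 4 = (0 :: nat)"
    by simp_all
  have verts: "verts (cycle_graph 4) = {0, 1, 2, 3}"
    unfolding cycle_graph_def by auto
  show "inj_on ?f (verts (cycle_graph 4))"
    unfolding verts using neq neq[symmetric] by simp
  show "?f ` verts (cycle_graph 4) \<subseteq> verts G"
    unfolding verts using assms(5-8) by simp
  show "\<forall>e\<in>edges (cycle_graph 4). ?f ` e \<in> edges G"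
  proof
    fix e assume "e \<in> edges (cycle_graph 4)"
    then obtain i where "i < 4" "e = {i, (i + 1) mod 4}"
      unfolding cycle_graph_def by auto
    then have "e = {0, 1} \<or> e = {1, 2} \<or> e = {2, 3} \<or> e = {3, 0}"
      using i4[OF \<open>i < 4\<close>] by (elim disjE) (simp_all only: m4 simp_thms)
    then show "?f ` e \<in> edges G"
      using assms(1-4) by (elim disjE) (simp_all add: insert_commute)
  qed
qed

text \<open>The image of \<open>g\<close> is closed under adjacency, hence all of \<open>G\<close>
  by connectedness. Listing the neighborhoods of the image vertices therefore identifies the whole
  graph.\<close>

lemma isomorphic_if_neighborhoods:
  assumes conn: "connected_graph G"
    and inj: "inj_on g (verts F)" and ne: "verts F \<noteq> {}" and sub: "g ` verts F \<subseteq> verts G"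
    and nbh: "\<And>i. i \<in> verts F \<Longrightarrow> neighborhood G (g i) = g ` neighborhood F i"
  shows "isomorphic G F"
proof -
  \<comment> \<open>Induction along a path that starts in the image: \<open>nbh\<close> keeps each
    next vertex in it.\<close>
  have closed: "last p \<in> g ` verts F"
    if "p \<noteq> []" "hd p \<in> g ` verts F" "set p \<subseteq> verts G" "successively (\<lambda>x y. {x, y} \<in> edges G) p"
    for p
    using that
  proof (induction p)
    case (Cons a q)
    show ?case
    proof (cases "q = []")
      case False
      from Cons.prems(2) obtain i where i: "i \<in> verts F" "a = g i" by auto
      have "hd q \<in> neighborhood G (g i)"
        using Cons.prems False by (cases q) (auto simp: neighborhood_def i)
      also have "\<dots> \<subseteq> g ` verts F"
        using nbh[OF i(1)] by (auto simp: neighborhood_def)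
      finally show ?thesis using Cons False by (auto simp: successively_Cons)
    qed (use Cons in auto)
  qed simp
  have surj: "verts G \<subseteq> g ` verts F"
  proof
    fix v assume v: "v \<in> verts G"
    from ne obtain i where i: "i \<in> verts F" by blast
    then obtain p where "is_path G (g i) p v"
      using conn v sub by (force simp: connected_graph_def)
    then show "v \<in> g ` verts F"
      using closed[of p] i by (auto simp: is_path_def)
  qed
  with inj sub have bij: "bij_betw g (verts F) (verts G)"
    by (auto simp: bij_betw_def)
  define f where "f = inv_into (verts F) g"
  have f: "f v \<in> verts F" "g (f v) = v" if "v \<in> verts G" for v
    using that surj by (auto simp: f_def inv_into_into f_inv_into_f)
  have "{u, v} \<in> edges G \<longleftrightarrow> {f u, f v} \<in> edges F" if uv: "u \<in> verts G" "v \<in> verts G" for u v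
  proof -
    have "{u, v} \<in> edges G \<longleftrightarrow> g (f v) \<in> neighborhood G (g (f u))"
      using uv f by (simp add: neighborhood_def)
    also have "\<dots> \<longleftrightarrow> g (f v) \<in> g ` neighborhood F (f u)"
      using nbh[OF f(1)[OF uv(1)]] by simp
    also have "\<dots> \<longleftrightarrow> f v \<in> neighborhood F (f u)"
      using inj f(1)[OF uv(2)] by (intro inj_on_image_mem_iff) (auto simp: neighborhood_def)
    also have "\<dots> \<longleftrightarrow> {f u, f v} \<in> edges F"
      using f uv by (simp add: neighborhood_def)
    finally show ?thesis .
  qed
  then show ?thesis
    unfolding isomorphic_def f_def using bij_betw_inv_into[OF bij] by blast
qed

section \<open>Common neighbors and distances\<close>

locale pos_curved_c4_free =
  fixes G :: "'a sgraph"
  assumes simple: "simple_graph G"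
    and locally_finite: "locally_finite_graph G"
    and conn: "connected_graph G"
    and curved: "positively_LLY_curved G"
    and c4_free: "graph_free (cycle_graph 4) G"
    and min_degree: "min_degree G \<ge> 2"
begin

definition adj :: "'a \<Rightarrow> 'a \<Rightarrow> bool" where
  "adj u v \<longleftrightarrow> {u, v} \<in> edges G"

abbreviation N :: "'a \<Rightarrow> 'a set" where
  "N \<equiv> neighborhood G"

lemma adj_commute: "adj u v \<longleftrightarrow> adj v u"
  by (simp add: adj_def insert_commute)

lemma adj_sym: "adj u v \<Longrightarrow> adj v u"
  using adj_commute by blast

lemma adj_neq: "adj u v \<Longrightarrow> u \<noteq> v"
  using simple by (auto simp: adj_def simple_graph_def)

lemma adj_verts: "adj u v \<Longrightarrow> u \<in> verts G" "adj u v \<Longrightarrow> v \<in> verts G"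
  using simple by (auto simp: adj_def simple_graph_def)

lemma mem_N [simp]: "v \<in> N u \<longleftrightarrow> adj u v"
  using adj_verts by (auto simp: neighborhood_def adj_def)

lemma finite_N: "u \<in> verts G \<Longrightarrow> finite (N u)"
  by (rule finite_neighborhood[OF locally_finite])

lemma card_N:
  assumes "u \<in> verts G"
  shows "card (N u) \<ge> 2"
proof -
  have "min_degree G \<le> degree G u"
    unfolding min_degree_def using assms by (intro cINF_lower) simp_all
  then show ?thesis using min_degree by (simp add: degree_def)
qed

text \<open>The form in which excluded 4-cycles are used throughout: apart from the distinctness of
  \<open>x\<close> and \<open>y\<close>, all inequalities follow from adjacency.\<close>

lemma c4:
  assumes "adj p x" "adj p y" "adj q x" "adj q y" "x \<noteq> y"
  shows "p = q"
proof (rule ccontr)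
  assume "p \<noteq> q"
  moreover have "p \<noteq> x" "p \<noteq> y" "q \<noteq> x" "q \<noteq> y"
    by (fact assms(1-4)[THEN adj_neq])+
  moreover have "p \<in> verts G" "q \<in> verts G" "x \<in> verts G" "y \<in> verts G"
    by (fact adj_verts[OF assms(1)] adj_verts[OF assms(4)])+
  ultimately have "contains_copy G (cycle_graph 4)"
    using assms unfolding adj_def by (intro contains_C4I)
  then show False using c4_free by (simp add: graph_free_def)
qed

lemma card_common_le:
  assumes "x \<noteq> y"
  shows "card (N x \<inter> N y) \<le> 1"
proof (cases "N x \<inter> N y = {}")
  case False
  then obtain z where z: "adj x z" "adj y z" by auto
  have "w = z" if "adj x w" "adj y w" for w
    using c4[of w x y z] z that assms adj_sym by blast
  with z have "N x \<inter> N y = {z}" unfolding set_eq_iff Int_iff mem_N by blast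
  then show ?thesis by simp
qed simp

lemma dist_path:
  assumes "u \<in> verts G" "v \<in> verts G"
  obtains p where "is_path G u p v" "length p = graph_dist G u v + 1"
proof -
  obtain p where p: "is_path G u p v"
    using conn assms unfolding connected_graph_def by blast
  then have "\<exists>q. is_path G u q v \<and> length q = (length p - 1) + 1"
    by (intro exI[of _ p]) (auto simp: is_path_def)
  then have "\<exists>q. is_path G u q v \<and> length q = graph_dist G u v + 1"
    unfolding graph_dist_def by (rule LeastI)
  then show ?thesis using that by blast
qed

text \<open>A shortest path with one, two or three vertices would make its ends equal, adjacent, or
  joined by a common neighbor.\<close>

lemma dist_ge:
  assumes "u \<in> verts G" "v \<in> verts G"
  shows "u \<noteq> v \<Longrightarrow> graph_dist G u v \<ge> 1"
    and "u \<noteq> v \<Longrightarrow> \<not> adj u v \<Longrightarrow> graph_dist G u v \<ge> 2"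
    and "u \<noteq> v \<Longrightarrow> \<not> adj u v \<Longrightarrow> \<nexists>w. adj u w \<and> adj v w \<Longrightarrow> graph_dist G u v \<ge> 3"
proof -
  obtain p where p: "is_path G u p v" "length p = graph_dist G u v + 1"
    using dist_path[OF assms] .
  note s = is_path_short[OF p(1)]
  have 0: "graph_dist G u v \<noteq> 0" if "u \<noteq> v"
    using s(1) that p(2) by fastforce
  then show "graph_dist G u v \<ge> 1" if "u \<noteq> v"
    using that by linarith
  have 1: "graph_dist G u v \<noteq> 1" if "\<not> adj u v"
    using s(2) that p(2) unfolding adj_def by fastforce
  show "graph_dist G u v \<ge> 2" if "u \<noteq> v" "\<not> adj u v"
    using 0 1 that by linarith
  have "graph_dist G u v \<noteq> 2" if "\<nexists>w. adj u w \<and> adj v w"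
    using s(3) that p(2) unfolding adj_def by fastforce
  then show "graph_dist G u v \<ge> 3" if "u \<noteq> v" "\<not> adj u v" "\<nexists>w. adj u w \<and> adj v w"
    using 0[OF that(1)] 1[OF that(2)] that(3) by fastforce
qed

lemma dist_adj:
  assumes "adj u v"
  shows "graph_dist G u v = 1"
proof -
  have "is_path G u [u, v] v"
    using assms adj_neq[OF assms] adj_verts[OF assms] by (auto simp: is_path_def adj_def)
  then have "graph_dist G u v \<le> 1"
    unfolding graph_dist_def by (intro Least_le) (auto intro!: exI[of _ "[u, v]"])
  moreover have "graph_dist G u v \<ge> 1"
    using dist_ge(1) adj_neq[OF assms] adj_verts[OF assms] by blast
  ultimately show ?thesis by simp
qed

text \<open>The numerical form of positive curvature. The potential \<open>\<phi>\<close> is 2 on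
  \<open>A\<close>, 0 at \<open>y\<close>, and 1 at \<open>x\<close> and at its remaining neighbors;
  \<open>\<psi>\<close> is 1 at \<open>x\<close>, -1 on \<open>B\<close>, and 0 at \<open>y\<close>
  and at its remaining neighbors; on common neighbors both equal \<open>c\<close>. Later uses either
  bound degrees (\<open>c = 0\<close>, \<open>B\<close> empty) or choose \<open>A\<close> and
  \<open>B\<close> so small that the inequality reads \<open>0 < 0\<close> and \<open>far\<close>
  must fail.\<close>

lemma edge_condition:
  fixes c :: int
  assumes xy: "adj x y"
    and A: "A \<subseteq> N x - insert y (N y)" and B: "B \<subseteq> N y - insert x (N x)"
    and far: "\<And>u v w. u \<in> A \<Longrightarrow> v \<in> B \<Longrightarrow> adj u w \<Longrightarrow> adj v w \<Longrightarrow> False"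
    and c: "c \<in> {0, 1}"
  shows "int (card (N y)) * (int (card A) - 1 - (1 - c) * int (card (N x \<inter> N y)))
    < int (card (N x)) * (1 + c * int (card (N x \<inter> N y)) - int (card B))"
proof -
  note v = adj_verts[OF xy]
  define \<phi> where "\<phi> v = 1 + of_bool (v \<in> A) - (1 - real_of_int c) * of_bool (v \<in> N x \<inter> N y)
    - of_bool (v = y)" for v
  define \<psi> where "\<psi> v = of_bool (v = x) + real_of_int c * of_bool (v \<in> N x \<inter> N y)
    - of_bool (v \<in> B)" for v
  have irr: "\<not> adj u u" for u using adj_neq by blast
  have AB: "x \<notin> A" "y \<notin> A" "x \<notin> B" "y \<notin> B" "A \<inter> N y = {}" "B \<inter> N x = {}"
    "A \<subseteq> N x" "B \<subseteq> N y"
    using A B irr by auto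
  have pos: "card (N x) > 0" "card (N y) > 0"
    using card_N v by fastforce+
  have lip: "\<phi> p - \<psi> q \<le> real (graph_dist G p q)" if pq: "p \<in> insert x (N x)" "q \<in> insert y (N y)" for p q
  proof -
    have pqv: "p \<in> verts G" "q \<in> verts G" using pq v adj_verts by auto
    \<comment> \<open>An edge between \<open>p\<close> and \<open>q\<close> would close the 4-cycle
      \<open>x\<close>, \<open>p\<close>, \<open>q\<close>, \<open>y\<close>.\<close>
    have nonadj: "\<not> adj p q" if "p \<in> N x - {y}" "q \<in> N y - {x}"
      using c4[of x p y q] that xy adj_commute by auto
    note d = dist_ge[OF pqv]
    have d1: "real (graph_dist G p q) \<ge> 1" if "p \<noteq> q" using d(1) that by simp
    have d2: "real (graph_dist G p q) \<ge> 2" if "p \<noteq> q" "\<not> adj p q" using d(2) that by simp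
    have c01: "0 \<le> real_of_int c" "real_of_int c \<le> 1" using c by auto
    show ?thesis
    proof (cases "p \<in> A")
      case True
      then have p: "p \<noteq> x" "p \<noteq> y" "\<not> adj p y" "\<not> adj y p" "adj x p" "\<phi> p = 2"
        using AB adj_commute by (auto simp: \<phi>_def)
      consider "q = x" | "q = y" | "q \<noteq> x" "adj y q" "q \<in> B" | "q \<noteq> x" "adj y q" "q \<notin> B"
        using pq by auto
      then show ?thesis
      proof cases
        case 1
        then show ?thesis using d1 p AB irr by (auto simp: \<psi>_def)
      next
        case 2
        then show ?thesis using d2 p AB irr adj_neq[OF xy] by (auto simp: \<psi>_def)
      next
        case 3
        then have "p \<noteq> q" "\<not> adj p q" using p nonadj by auto
        \<comment> \<open>The extreme difference 2 - (-1) = 3, the one place where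
          \<open>far\<close> enters.\<close>
        then have "graph_dist G p q \<ge> 3" using d(3) far[OF True 3(3)] by blast
        moreover have "\<psi> q = -1" using 3 AB by (auto simp: \<psi>_def)
        ultimately show ?thesis using p by simp
      next
        case 4
        then have "p \<noteq> q" "\<not> adj p q" using p nonadj by auto
        moreover have "\<psi> q \<ge> 0" using 4 c01 by (auto simp: \<psi>_def)
        ultimately show ?thesis using p d2 by simp
      qed
    next
      case False
      have p1: "\<phi> p \<le> 1" using False c01 by (auto simp: \<phi>_def)
      show ?thesis
      proof (cases "q \<in> B")
        case True
        then have q: "q \<noteq> x" "q \<noteq> y" "adj y q" "\<not> adj x q" "\<psi> q = -1"
          using AB irr by (auto simp: \<psi>_def)
        show ?thesis
        proof (cases "p = y")
          case True
          then have "\<phi> p = 0" using AB irr by (auto simp: \<phi>_def)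
          then show ?thesis using d1 q True by simp
        next
          case False
          then have "p \<noteq> q" "\<not> adj p q" using q nonadj pq by auto
          then show ?thesis using d2 p1 q by simp
        qed
      next
        case q: False
        then have q0: "\<psi> q \<ge> 0" using c01 by (auto simp: \<psi>_def)
        show ?thesis
        proof (cases "p = q")
          case True
          \<comment> \<open>The two closed neighborhoods overlap in \<open>x\<close>,
            \<open>y\<close> and the common neighbors, where the potentials were chosen
            equal.\<close>
          then have "\<phi> p = \<psi> q"
            using pq False q adj_neq[OF xy] irr adj_commute by (auto simp: \<phi>_def \<psi>_def)
          then show ?thesis by simp
        next
          case False
          then show ?thesis using d1 p1 q0 by simp
        qed
      qed
    qed
  qed
  have "N x \<inter> {v. v = y} = {y}" "N y \<inter> {v. v = x} = {x}" using xy adj_commute by auto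
  moreover have "N x \<inter> {v. v \<in> A} = A" "N y \<inter> {v. v \<in> B} = B" using AB by auto
  moreover have "N x \<inter> Collect (adj y) = N x \<inter> N y" "N y \<inter> Collect (adj x) = N x \<inter> N y"
    by auto
  ultimately have sums: "sum \<phi> (N x) = card (N x) + card A - (1 - c) * card (N x \<inter> N y) - 1"
    "sum \<psi> (N y) = 1 + c * card (N x \<inter> N y) - card B"
    using finite_N v
    by (simp_all add: \<phi>_def \<psi>_def sum.distrib sum_subtractf flip: sum_distrib_left)
  have "\<phi> x - \<psi> y = 1"
    using AB irr adj_neq[OF xy] by (auto simp: \<phi>_def \<psi>_def)
  from kappa_LLY_le[OF simple locally_finite v _ _ dist_adj[OF xy] lip this] curved v xy pos
  have "sum \<phi> (N x) / card (N x) - sum \<psi> (N y) / card (N y) < 1"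
    by (force simp: positively_LLY_curved_def adj_def degree_def)
  then have "sum \<phi> (N x) * card (N y) - sum \<psi> (N y) * card (N x) < card (N x) * card (N y)"
    using pos by (simp add: field_simps)
  then have "real_of_int (int (card (N y)) * (int (card A) - 1 - (1 - c) * int (card (N x \<inter> N y))))
    < real_of_int (int (card (N x)) * (1 + c * int (card (N x \<inter> N y)) - int (card B)))"
    unfolding sums by (simp add: algebra_simps)
  then show ?thesis by (simp only: of_int_less_iff)
qed

end

section \<open>Edges in no triangle\<close>

lemma nth_labelling_isomorphic:
  assumes "connected_graph G" "distinct vs" "vs \<noteq> []" "set vs \<subseteq> verts G"
    and "verts F = {0..<length vs}"
    and "\<And>i. i < length vs \<Longrightarrow> neighborhood G (vs ! i) = (\<lambda>j. vs ! j) ` neighborhood F i"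
  shows "isomorphic G F"
  using assms
  by (intro isomorphic_if_neighborhoods[where g = "\<lambda>i. vs ! i"])
    (auto simp: inj_on_def nth_eq_iff_index_eq)

lemma neighborhood_cycle_graph:
  assumes "i < n"
  shows "neighborhood (cycle_graph n) i = {j. j < n \<and> (j = (i + 1) mod n \<or> i = (j + 1) mod n)}"
  using assms by (auto simp: neighborhood_def cycle_graph_def doubleton_eq_iff)

lemma neighborhood_C3:
  "neighborhood (cycle_graph 3) 0 = {1, 2}"
  "neighborhood (cycle_graph 3) 1 = {0, 2}"
  "neighborhood (cycle_graph 3) 2 = {0, 1}"
  by (simp_all only: neighborhood_cycle_graph set_eq_iff mem_Collect_eq insert_iff empty_iff
      zero_less_numeral one_less_numeral_iff numeral_less_iff semiring_norm) presburger+

lemma neighborhood_C5: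
  "neighborhood (cycle_graph 5) 0 = {1, 4}"
  "neighborhood (cycle_graph 5) 1 = {0, 2}"
  "neighborhood (cycle_graph 5) 2 = {1, 3}"
  "neighborhood (cycle_graph 5) 3 = {2, 4}"
  "neighborhood (cycle_graph 5) 4 = {0, 3}"
  by (simp_all only: neighborhood_cycle_graph set_eq_iff mem_Collect_eq insert_iff empty_iff
      zero_less_numeral one_less_numeral_iff numeral_less_iff semiring_norm) presburger+

lemma neighborhood_T:
  "neighborhood T_graph 0 = {1, 2, 3}"
  "neighborhood T_graph 1 = {0, 2, 4}"
  "neighborhood T_graph 2 = {0, 1, 5}"
  "neighborhood T_graph 3 = {0, 6}"
  "neighborhood T_graph 4 = {1, 6}"
  "neighborhood T_graph 5 = {2, 6}"
  "neighborhood T_graph 6 = {3, 4, 5}"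
  by (auto simp: neighborhood_def T_graph_def doubleton_eq_iff)


context pos_curved_c4_free
begin

lemma C3_recognition:
  assumes "a \<noteq> b" "a \<noteq> c" "b \<noteq> c" "N a = {b, c}" "N b = {a, c}" "N c = {a, b}"
  shows "isomorphic G (cycle_graph 3)"
proof (rule nth_labelling_isomorphic[OF conn])
  let ?vs = "[a, b, c]"
  show "distinct ?vs" using assms by auto
  have "adj a b" "adj b c" using assms(4,5) by (simp_all flip: mem_N)
  then show "set ?vs \<subseteq> verts G" using adj_verts by auto
  fix i assume "i < length ?vs"
  then have "i = 0 \<or> i = 1 \<or> i = 2" by auto
  then show "N (?vs ! i) = (\<lambda>j. ?vs ! j) ` neighborhood (cycle_graph 3) i"
    by (elim disjE) (simp_all add: neighborhood_C3 assms(4-) del: One_nat_def)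
qed (auto simp: cycle_graph_def)

lemma C5_recognition:
  assumes "distinct [a, b, c, d, e]"
    and "N a = {b, e}" "N b = {a, c}" "N c = {b, d}" "N d = {c, e}" "N e = {a, d}"
  shows "isomorphic G (cycle_graph 5)"
proof (rule nth_labelling_isomorphic[OF conn assms(1)])
  let ?vs = "[a, b, c, d, e]"
  have "adj a b" "adj b c" "adj d e" using assms(2-) by (simp_all flip: mem_N)
  then show "set ?vs \<subseteq> verts G" using adj_verts by auto
  fix i assume "i < length ?vs"
  then have "i = 0 \<or> i = 1 \<or> i = 2 \<or> i = 3 \<or> i = 4" by auto
  then show "N (?vs ! i) = (\<lambda>j. ?vs ! j) ` neighborhood (cycle_graph 5) i"
    by (elim disjE) (simp_all add: neighborhood_C5 assms(2-) del: One_nat_def)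
qed (auto simp: cycle_graph_def)

lemma T_recognition:
  assumes "distinct [a1, a2, a3, b1, b2, b3, c]"
    and "N a1 = {a2, a3, b1}" "N a2 = {a1, a3, b2}" "N a3 = {a1, a2, b3}"
    and "N b1 = {a1, c}" "N b2 = {a2, c}" "N b3 = {a3, c}" "N c = {b1, b2, b3}"
  shows "isomorphic G T_graph"
proof (rule nth_labelling_isomorphic[OF conn assms(1)])
  let ?vs = "[a1, a2, a3, b1, b2, b3, c]"
  have "adj a1 a2" "adj a3 b3" "adj c b1" "adj c b2" using assms(2-) by (simp_all flip: mem_N)
  then show "set ?vs \<subseteq> verts G" using adj_verts by auto
  fix i assume "i < length ?vs"
  then have "i = 0 \<or> i = 1 \<or> i = 2 \<or> i = 3 \<or> i = 4 \<or> i = 5 \<or> i = 6" by auto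
  then show "N (?vs ! i) = (\<lambda>j. ?vs ! j) ` neighborhood T_graph i"
    by (elim disjE) (simp_all add: neighborhood_T assms(2-) del: One_nat_def)
qed (auto simp: T_graph_def)

section \<open>Degrees and pentagons at an edge in no triangle\<close>

lemma adj_irrefl: "\<not> adj u u"
  using adj_neq by blast

lemma no_triangle_iff: "N x \<inter> N y = {} \<longleftrightarrow> (\<forall>w. adj x w \<longrightarrow> \<not> adj y w)"
  by auto

lemma N_eqI:
  assumes "u \<in> verts G" "S \<subseteq> N u" "card (N u) \<le> card S"
  shows "N u = S"
  using card_seteq[OF finite_N[OF assms(1)] assms(2,3)] by simp

text \<open>This is \<open>edge_condition\<close> with \<open>A\<close> all neighbors of
  \<open>x\<close> except \<open>y\<close>, and \<open>B\<close> empty.\<close>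

lemma no_triangle_degree_less:
  assumes xy: "adj x y" and disj: "N x \<inter> N y = {}"
  shows "card (N y) * (card (N x) - 2) < card (N x)"
proof -
  note v = adj_verts[OF xy]
  have "N x - insert y (N y) = N x - {y}" using disj by auto
  moreover have "card (N x - {y}) = card (N x) - 1"
    using xy finite_N[OF v(1)] by (simp add: card_Diff_singleton)
  moreover have "card (N x) \<ge> 2" using card_N v by blast
  moreover have "int (card (N y)) * (int (card (N x - insert y (N y))) - 1) < int (card (N x))"
    using edge_condition[OF xy, of "N x - insert y (N y)" "{}" 0] disj by simp
  ultimately have "int (card (N y) * (card (N x) - 2)) < int (card (N x))"
    by (simp add: of_nat_diff algebra_simps)
  then show ?thesis by (simp only: of_nat_less_iff)
qed

text \<open>As the other degree is at least 2, a degree d satisfies 2(d - 2) < d, so it is 2 or 3.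
  Degrees (3,3) would give 3 < 3.\<close>

lemma no_triangle_degrees:
  assumes xy: "adj x y" and disj: "N x \<inter> N y = {}"
  shows "card (N x) \<in> {2, 3}" "card (N x) = 2 \<or> card (N y) = 2"
proof -
  have le: "card (N u) \<le> 3" if "adj u v" "N u \<inter> N v = {}" for u v
  proof -
    have "2 * (card (N u) - 2) \<le> card (N v) * (card (N u) - 2)"
      using card_N adj_verts[OF that(1)] by (intro mult_right_mono) auto
    then show ?thesis using no_triangle_degree_less[OF that] by linarith
  qed
  have yx: "adj y x" "N y \<inter> N x = {}" using xy disj adj_sym by auto
  have "card (N x) \<ge> 2" "card (N y) \<ge> 2" using card_N adj_verts[OF xy] by auto
  with le[OF xy disj] le[OF yx]
  have d: "card (N x) = 2 \<or> card (N x) = 3" "card (N y) = 2 \<or> card (N y) = 3" by linarith+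
  then show "card (N x) \<in> {2, 3}" by simp
  show "card (N x) = 2 \<or> card (N y) = 2"
    using d no_triangle_degree_less[OF xy disj] by auto
qed

text \<open>Without a common neighbor of \<open>u\<close> and \<open>v\<close>,
  \<open>edge_condition\<close> for the singletons \<open>{u}\<close> and \<open>{v}\<close> reads
  \<open>0 < 0\<close>.\<close>

lemma no_triangle_pentagon:
  assumes "adj x y" "N x \<inter> N y = {}" "adj x u" "u \<noteq> y" "adj y v" "v \<noteq> x"
  obtains w where "adj u w" "adj v w"
proof (rule ccontr)
  assume "\<not> thesis"
  then have "\<not> (adj u w \<and> adj v w)" for w using that by blast
  then show False
    using edge_condition[of x y "{u}" "{v}" 0] assms by (auto simp: no_triangle_iff)
qed

text \<open>Two pentagons share the path \<open>y\<close>, \<open>x\<close>, \<open>x1\<close>. The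
  chord between \<open>y1\<close> and \<open>y2\<close> creates the triangle of T on
  \<open>y\<close>, \<open>y1\<close>, \<open>y2\<close>; its leaves are \<open>x\<close>,
  \<open>w1\<close>, \<open>w2\<close>, and \<open>x1\<close> is the center of the star.\<close>

lemma T_from_hexagon:
  assumes xy: "adj x y" and disj: "N x \<inter> N y = {}"
    and Nx: "N x = {y, x1}" "y \<noteq> x1" and Ny: "N y = {x, y1, y2}" and Nx1: "N x1 = {x, w1, w2}"
    and distinct: "y1 \<noteq> y2" "w1 \<noteq> w2" "x \<noteq> y1" "x \<noteq> y2" "x \<noteq> w1" "x \<noteq> w2"
    and adj: "adj y1 w1" "adj y2 w2" "adj y1 y2" and w: "\<not> adj w1 w2"
  shows "isomorphic G T_graph"
proof -
  have adj_y: "adj y x" "adj y y1" "adj y y2" and adj_x: "adj x x1"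
    and adj_x1: "adj x1 x" "adj x1 w1" "adj x1 w2"
    using Nx(1) Ny Nx1 by (simp_all flip: mem_N)
  have x1y: "\<not> adj x1 y" "y \<noteq> x1"
    using adj_x disj adj_sym Nx(2) by (auto simp: no_triangle_iff)
  have x1y_i: "\<not> adj x1 y1" "\<not> adj x1 y2"
    using c4[OF adj_x1(1) _ adj_y(1)] adj_y x1y distinct by blast+
  have neq: "y \<noteq> w1" "y \<noteq> w2" "x1 \<noteq> y1" "x1 \<noteq> y2" "y1 \<noteq> w1" "y1 \<noteq> w2" "y2 \<noteq> w1" "y2 \<noteq> w2"
    using x1y x1y_i adj_x1 adj_y adj_sym by blast+
  have card: "card (N y) = 3" "card (N x1) = 3"
    unfolding Ny Nx1 using distinct by simp_all
  have xw: "\<not> adj x w1" "\<not> adj x w2"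
    using neq adj_x1 adj_irrefl unfolding mem_N[symmetric] Nx(1) by auto
  \<comment> \<open>The edge from \<open>x1\<close> to \<open>w\<close> lies in no triangle and
    \<open>x1\<close> has degree 3, so \<open>w\<close> has degree 2. Then the edge from
    \<open>v\<close> to \<open>w\<close> lies in no triangle either, so \<open>v\<close> has degree
    at most 3. Applied to \<open>(w1, y1)\<close> and \<open>(w2, y2)\<close>.\<close>
  have leaf: "N w = {x1, v} \<and> N v = {y, v', w}"
    if "adj x1 w" "adj v w" "adj y v" "adj v v'" "N x1 \<inter> N w = {}" "\<not> adj x1 v" "\<not> adj x1 v'"
      "x1 \<noteq> v" "y \<noteq> v'" "y \<noteq> w"
    for v v' w
  proof -
    have "card (N w) = 2"
      using no_triangle_degrees[OF that(1,5)] card by auto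
    then have Nw: "N w = {x1, v}"
      using that adj_verts adj_sym by (intro N_eqI) auto
    have "N v \<inter> N w = {}"
      using Nw \<open>\<not> adj x1 v\<close> adj_irrefl adj_commute by auto
    then have "card (N v) \<le> 3"
      using no_triangle_degrees(1)[OF \<open>adj v w\<close>] by auto
    moreover have "v' \<noteq> w" using that by auto
    ultimately have "N v = {y, v', w}"
      using that adj_verts adj_sym by (intro N_eqI) auto
    with Nw show ?thesis by blast
  qed
  have "N x1 \<inter> N w1 = {}" "N x1 \<inter> N w2 = {}"
    unfolding Nx1 using xw w adj_irrefl adj_sym by auto
  then have "N w1 = {x1, y1} \<and> N y1 = {y, y2, w1}" "N w2 = {x1, y2} \<and> N y2 = {y, y1, w2}"
    using leaf[of w1 y1 y2] leaf[of w2 y2 y1] adj adj_sym adj_x1 adj_y x1y_i neq adj_neq[OF adj_y(2)]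
      adj_neq[OF adj_y(3)] by simp_all
  moreover have "distinct [y, y1, y2, x, w1, w2, x1]"
    using adj_neq[OF adj_y(1)] adj_neq[OF adj_y(2)] adj_neq[OF adj_y(3)] adj_neq[OF adj_x]
      adj_neq[OF adj_x1(2)] adj_neq[OF adj_x1(3)] neq neq[symmetric] distinct distinct[symmetric] x1y
    by simp
  ultimately show ?thesis
    using Nx(1) Ny Nx1 by (intro T_recognition[of y y1 y2 x w1 w2 x1]) auto
qed

lemma card_N_eq_2E:
  assumes "card (N x) = 2" "adj x y"
  obtains z where "N x = {y, z}" "y \<noteq> z"
proof -
  obtain a b where "N x = {a, b}" "a \<noteq> b"
    using assms(1) by (auto simp: card_2_iff)
  moreover have "y \<in> N x" using assms(2) by simp
  ultimately show ?thesis using that[of a] that[of b] by auto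
qed

lemma card_N_eq_3E:
  assumes "card (N x) = 3" "adj x y"
  obtains z z' where "N x = {y, z, z'}" "y \<noteq> z" "y \<noteq> z'" "z \<noteq> z'"
proof -
  have "card (N x - {y}) = 2"
    using assms by (simp add: card_Diff_singleton)
  then obtain a b where "N x - {y} = {a, b}" "a \<noteq> b"
    by (auto simp: card_2_iff)
  moreover have "y \<in> N x" using assms(2) by simp
  ultimately show ?thesis using that[of a b] by blast
qed

text \<open>The pentagons through \<open>y1\<close> and through \<open>y2\<close> determine the
  neighborhood of \<open>x1\<close>. The chords \<open>y1 y2\<close> and \<open>w1 w2\<close> then
  decide: both give a 4-cycle, exactly one gives T, and none contradicts a further pentagon.\<close>

lemma T_case:
  assumes xy: "adj x y" and disj: "N x \<inter> N y = {}" and card: "card (N x) = 2" "card (N y) = 3"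
  shows "isomorphic G T_graph"
proof -
  obtain x1 where Nx: "N x = {y, x1}" "y \<noteq> x1" using card_N_eq_2E[OF card(1) xy] .
  obtain y1 y2 where Ny: "N y = {x, y1, y2}" "x \<noteq> y1" "x \<noteq> y2" "y1 \<noteq> y2"
    using card_N_eq_3E[OF card(2) adj_sym[OF xy]] .
  have adj_y: "adj y x" "adj y y1" "adj y y2" and adj_x: "adj x x1"
    using Nx Ny by (simp_all flip: mem_N)
  obtain w1 where w1: "adj x1 w1" "adj y1 w1"
    using no_triangle_pentagon[OF xy disj adj_x _ adj_y(2)] Nx Ny by metis
  obtain w2 where w2: "adj x1 w2" "adj y2 w2"
    using no_triangle_pentagon[OF xy disj adj_x _ adj_y(3)] Nx Ny by metis
  have x1y: "\<not> adj x1 y"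
    using adj_x disj adj_sym by (auto simp: no_triangle_iff)
  have x1y_i: "\<not> adj x1 y1" "\<not> adj x1 y2"
    using c4[OF adj_sym[OF adj_x] _ adj_y(1)] adj_y Nx Ny by blast+
  \<comment> \<open>Otherwise \<open>y\<close>, \<open>y1\<close>, \<open>w1\<close>,
    \<open>y2\<close> would form a 4-cycle.\<close>
  have "w1 \<noteq> w2"
    using c4[OF adj_y(2,3) adj_sym[OF w1(2)]] w1 w2 x1y adj_sym Ny by blast
  have xw: "x \<noteq> w1" "x \<noteq> w2"
    using w1 w2 disj adj_y adj_sym by (auto simp: no_triangle_iff)
  have disj1: "N x \<inter> N x1 = {}"
    using Nx x1y adj_irrefl by auto
  have "card (N x1) \<le> 3"
    using no_triangle_degrees(1)[OF adj_sym[OF adj_x]] disj1 by (auto simp: Int_commute)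
  then have Nx1: "N x1 = {x, w1, w2}"
    using w1 w2 adj_x adj_verts adj_sym xw \<open>w1 \<noteq> w2\<close> by (intro N_eqI) auto
  have leaf: "card (N v) = 2"
    if "adj u v" "N u = {x, v, v'}" "card (N u) = 3" "\<not> adj v v'" "\<not> adj x v" for u v v'
  proof -
    have "N u \<inter> N v = {}" using that adj_irrefl adj_commute by auto
    then show ?thesis using no_triangle_degrees(2)[OF that(1)] that(3) by auto
  qed
  have xy_i: "\<not> adj x y1" "\<not> adj x w1"
    using disj adj_y w1 disj1 by (auto simp: no_triangle_iff)
  show ?thesis
  proof (cases "adj y1 y2"; cases "adj w1 w2")
    assume "adj y1 y2" "adj w1 w2"
    then have "y1 = w2"
      using c4[of y1 y2 w1 w2] w1 w2 adj_sym x1y_i by blast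
    then show ?thesis using w2 x1y_i by blast
  next
    assume "adj y1 y2" "\<not> adj w1 w2"
    then show ?thesis
      using T_from_hexagon[OF xy disj Nx Ny(1) Nx1] Ny xw \<open>w1 \<noteq> w2\<close> w1 w2 by blast
  next
    \<comment> \<open>The mirror image of the previous case: \<open>y\<close> and \<open>x1\<close>
      exchange roles, and so do the two chords.\<close>
    assume "\<not> adj y1 y2" "adj w1 w2"
    moreover have "N x = {x1, y}" using Nx by auto
    ultimately show ?thesis
      using T_from_hexagon[OF adj_x disj1 _ Nx(2)[symmetric] Nx1 Ny(1)] Ny xw \<open>w1 \<noteq> w2\<close> w1 w2 adj_sym by blast
  next
    assume y: "\<not> adj y1 y2" and w: "\<not> adj w1 w2"
    have "card (N y1) = 2" "card (N w1) = 2"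
      using leaf[OF adj_y(2) Ny(1)] leaf[OF w1(1) Nx1] y w xy_i card Nx1 xw \<open>w1 \<noteq> w2\<close> by auto
    moreover have "y \<noteq> w1" "x1 \<noteq> y1" using x1y w1 xy_i adj_x by auto
    ultimately have Ny1: "N y1 = {y, w1}" and Nw1: "N w1 = {x1, y1}"
      using w1 adj_y adj_x adj_verts adj_sym by (intro N_eqI; auto)+
    have "N y \<inter> N y1 = {}" using Ny(1) y xy_i adj_irrefl adj_commute by auto
    \<comment> \<open>The pentagon over the edge from \<open>y\<close> to \<open>y1\<close> has its
      apex \<open>t\<close> in \<open>{x1, y1}\<close>, but \<open>y2\<close> is adjacent to
      neither.\<close>
    then obtain t where "adj y2 t" "adj w1 t"
      using no_triangle_pentagon[OF adj_y(2) _ adj_y(3) _ w1(2)] Ny \<open>y \<noteq> w1\<close> by metis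
    then have "adj y2 x1 \<or> adj y2 y1" using Nw1 by (auto simp flip: mem_N)
    then show ?thesis using x1y_i y adj_sym by blast
  qed
qed

text \<open>With T excluded, \<open>T_case\<close> leaves degree 2 at both ends of every edge in no
  triangle. Around the pentagon each next edge is again in no triangle, so all five degrees are
  2.\<close>

lemma C5_case:
  assumes xy: "adj x y" and disj: "N x \<inter> N y = {}"
  shows "isomorphic G (cycle_graph 5) \<or> isomorphic G T_graph"
proof (rule disjCI)
  assume nT: "\<not> isomorphic G T_graph"
  have two: "card (N u) = 2" if "adj u v" "N u \<inter> N v = {}" for u v
    using no_triangle_degrees[OF that] T_case[of v u] that nT adj_sym by (auto simp: Int_commute)
  have yx: "adj y x" "N y \<inter> N x = {}" using xy disj adj_sym by auto
  obtain x1 where Nx: "N x = {y, x1}" "y \<noteq> x1" using card_N_eq_2E[OF two[OF xy disj] xy] .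
  obtain y1 where Ny: "N y = {x, y1}" "x \<noteq> y1" using card_N_eq_2E[OF two[OF yx] yx(1)] .
  have adj: "adj x x1" "adj y y1" using Nx Ny by (simp_all flip: mem_N)
  obtain w where w: "adj x1 w" "adj y1 w"
    using no_triangle_pentagon[OF xy disj adj(1) _ adj(2)] Nx Ny by metis
  have nadj: "\<not> adj x1 y" "\<not> adj y1 x"
    using adj disj adj_sym by (auto simp: no_triangle_iff)
  have "N x1 \<inter> N x = {}" "N y1 \<inter> N y = {}"
    using Nx(1) Ny(1) nadj adj_irrefl by auto
  then have "card (N x1) = 2" "card (N y1) = 2" using two adj adj_sym by blast+
  moreover have neq: "w \<noteq> x" "w \<noteq> y" using nadj w by auto
  ultimately have Nx1: "N x1 = {x, w}" and Ny1: "N y1 = {y, w}"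
    using w adj adj_verts adj_sym by (intro N_eqI; auto)+
  have neq': "x1 \<noteq> y1" using adj(2) nadj adj_sym by blast
  have "\<not> adj y w" "\<not> adj x w"
    using Nx(1) Ny(1) neq w adj_irrefl unfolding mem_N[symmetric] by auto
  then have "N w \<inter> N y1 = {}"
    using Ny1 adj_irrefl adj_sym by auto
  then have "card (N w) = 2" using two w adj_sym by blast
  then have "N w = {y1, x1}"
    using w adj_verts adj_sym neq' by (intro N_eqI) auto
  moreover have "distinct [x, y, y1, w, x1]"
    using neq neq' Nx(2) Ny(2) adj_neq[OF xy] adj_neq[OF adj(1)] adj_neq[OF adj(2)]
      adj_neq[OF w(1)] adj_neq[OF w(2)] by auto
  ultimately show "isomorphic G (cycle_graph 5)"
    using Nx Ny Nx1 Ny1 by (intro C5_recognition[of x y y1 w x1]) auto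
qed

end

section \<open>Edges in triangles and friendship graphs\<close>

lemma neighborhood_F2:
  "neighborhood (friendship_graph 2) 0 = {1, 2, 3, 4}"
  "neighborhood (friendship_graph 2) 1 = {0, 2}"
  "neighborhood (friendship_graph 2) 2 = {0, 1}"
  "neighborhood (friendship_graph 2) 3 = {0, 4}"
  "neighborhood (friendship_graph 2) 4 = {0, 3}"
proof -
  have i: "{..<2} = {0, 1 :: nat}" by auto
  note [simp] = neighborhood_def friendship_graph_def i doubleton_eq_iff
  show "neighborhood (friendship_graph 2) 0 = {1, 2, 3, 4}" by auto
  show "neighborhood (friendship_graph 2) 1 = {0, 2}" by auto
  show "neighborhood (friendship_graph 2) 2 = {0, 1}" by auto
  show "neighborhood (friendship_graph 2) 3 = {0, 4}" by auto
  show "neighborhood (friendship_graph 2) 4 = {0, 3}" by auto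
qed

lemma neighborhood_F3:
  "neighborhood (friendship_graph 3) 0 = {1, 2, 3, 4, 5, 6}"
  "neighborhood (friendship_graph 3) 1 = {0, 2}"
  "neighborhood (friendship_graph 3) 2 = {0, 1}"
  "neighborhood (friendship_graph 3) 3 = {0, 4}"
  "neighborhood (friendship_graph 3) 4 = {0, 3}"
  "neighborhood (friendship_graph 3) 5 = {0, 6}"
  "neighborhood (friendship_graph 3) 6 = {0, 5}"
proof -
  have i: "{..<3} = {0, 1, 2 :: nat}" by auto
  note [simp] = neighborhood_def friendship_graph_def i doubleton_eq_iff
  show "neighborhood (friendship_graph 3) 0 = {1, 2, 3, 4, 5, 6}" by auto
  show "neighborhood (friendship_graph 3) 1 = {0, 2}" by auto
  show "neighborhood (friendship_graph 3) 2 = {0, 1}" by auto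
  show "neighborhood (friendship_graph 3) 3 = {0, 4}" by auto
  show "neighborhood (friendship_graph 3) 4 = {0, 3}" by auto
  show "neighborhood (friendship_graph 3) 5 = {0, 6}" by auto
  show "neighborhood (friendship_graph 3) 6 = {0, 5}" by auto
qed

context pos_curved_c4_free
begin

lemma F2_recognition:
  assumes "distinct [x, p, q, r, s]" "N x = {p, q, r, s}"
    and "N p = {x, q}" "N q = {x, p}" "N r = {x, s}" "N s = {x, r}"
  shows "isomorphic G (friendship_graph 2)"
proof (rule nth_labelling_isomorphic[OF conn assms(1)])
  let ?vs = "[x, p, q, r, s]"
  have "adj x p" "adj x q" "adj x r" "adj x s" using assms(2) by (simp_all flip: mem_N)
  then show "set ?vs \<subseteq> verts G" using adj_verts by auto
  fix i assume "i < length ?vs"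
  then have "i = 0 \<or> i = 1 \<or> i = 2 \<or> i = 3 \<or> i = 4" by auto
  then show "N (?vs ! i) = (\<lambda>j. ?vs ! j) ` neighborhood (friendship_graph 2) i"
    by (elim disjE) (simp_all add: neighborhood_F2 assms(2-) del: One_nat_def)
qed (auto simp: friendship_graph_def)

lemma F3_recognition:
  assumes "distinct [x, p, q, r, s, t, u]" "N x = {p, q, r, s, t, u}"
    and "N p = {x, q}" "N q = {x, p}" "N r = {x, s}" "N s = {x, r}" "N t = {x, u}" "N u = {x, t}"
  shows "isomorphic G (friendship_graph 3)"
proof (rule nth_labelling_isomorphic[OF conn assms(1)])
  let ?vs = "[x, p, q, r, s, t, u]"
  have "adj x p" "adj x q" "adj x r" "adj x s" "adj x t" "adj x u"
    using assms(2) by (simp_all flip: mem_N)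
  then show "set ?vs \<subseteq> verts G" using adj_verts by auto
  fix i assume "i < length ?vs"
  then have "i = 0 \<or> i = 1 \<or> i = 2 \<or> i = 3 \<or> i = 4 \<or> i = 5 \<or> i = 6" by auto
  then show "N (?vs ! i) = (\<lambda>j. ?vs ! j) ` neighborhood (friendship_graph 3) i"
    by (elim disjE) (simp_all add: neighborhood_F3 assms(2-) del: One_nat_def)
qed (auto simp: friendship_graph_def)

section \<open>Degree bound and matching condition at an edge in a triangle\<close>

lemma common_unique:
  assumes "adj x y" "adj x z" "adj y z" "adj x w" "adj y w"
  shows "w = z"
  using c4[of w x y z] assms adj_sym adj_neq by blast

text \<open>This is \<open>edge_condition\<close> with \<open>c = 0\<close>, \<open>B\<close> empty
  and \<open>A\<close> all neighbors of \<open>x\<close> outside the unique triangle on the edge,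
  which removes two vertices.\<close>

lemma triangle_degree_less:
  assumes xy: "adj x y" and tri: "N x \<inter> N y \<noteq> {}"
  shows "int (card (N y)) * (int (card (N x)) - 4) < int (card (N x))"
proof -
  note v = adj_verts[OF xy]
  have fin: "finite (N x)" using finite_N v by blast
  have Z: "card (N x \<inter> N y) = 1"
    using card_common_le[OF adj_neq[OF xy]] tri fin by (simp add: le_Suc_eq)
  have "N x = (N x - insert y (N y)) \<union> ({y} \<union> (N x \<inter> N y))" using xy by auto
  then have "card (N x) = card (N x - insert y (N y)) + card ({y} \<union> (N x \<inter> N y))"
    using fin card_Un_disjoint[of "N x - insert y (N y)" "{y} \<union> (N x \<inter> N y)"] by auto
  moreover have "card ({y} \<union> (N x \<inter> N y)) = 2"
    using Z fin adj_irrefl by (subst card_Un_disjoint) auto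
  moreover have "int (card (N y)) * (int (card (N x - insert y (N y))) - 2) < int (card (N x))"
    using edge_condition[OF xy, of "N x - insert y (N y)" "{}" 0] Z by simp
  ultimately show ?thesis by simp
qed

text \<open>For \<open>c = 1\<close>, the sets \<open>{u}\<close> and \<open>{v, v'}\<close> make
  both sides of \<open>edge_condition\<close> zero, so they cannot be far apart.\<close>

lemma triangle_matching:
  assumes xy: "adj x y" and z: "adj x z" "adj y z"
    and u: "adj x u" "u \<noteq> y" "u \<noteq> z"
    and v: "adj y v" "v \<noteq> x" "v \<noteq> z" "adj y v'" "v' \<noteq> x" "v' \<noteq> z" "v \<noteq> v'"
  obtains w where "adj u w" "adj v w \<or> adj v' w"
proof (rule ccontr)
  assume "\<not> thesis"
  then have no: "\<not> (adj u w \<and> (adj v w \<or> adj v' w))" for w using that by blast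
  have n: "\<not> adj y u" "\<not> adj x v" "\<not> adj x v'"
    using common_unique[OF xy z] u v by blast+
  have "N x \<inter> N y = {z}" using common_unique[OF xy z] z unfolding set_eq_iff Int_iff mem_N by blast
  then show False
    using edge_condition[OF xy, of "{u}" "{v, v'}" 1] no n u v by fastforce
qed

end

section \<open>Neighborhoods as perfect matchings\<close>

locale pos_curved_triangulated = pos_curved_c4_free +
  assumes triangles: "adj x y \<Longrightarrow> \<exists>z. adj x z \<and> adj y z"
begin

text \<open>Every neighbor of \<open>x\<close> has exactly one partner in \<open>N x\<close>. If
  \<open>S\<close> is closed under partners, then any vertex outside \<open>S\<close> has its
  partner outside too, so one more pair can be split off.\<close>

lemma next_pair:
  assumes S: "S \<subseteq> N x" "N x \<noteq> S" and closed: "\<And>s. s \<in> S \<Longrightarrow> \<exists>t\<in>S. adj s t"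
  obtains p q where "adj p q" "adj x p" "adj x q" "p \<notin> S" "q \<notin> S"
proof -
  have "\<not> N x \<subseteq> S" using S by blast
  then obtain p where p: "adj x p" "p \<notin> S" unfolding subset_iff mem_N by blast
  then obtain q where q: "adj x q" "adj p q" using triangles by blast
  have "q \<notin> S"
  proof
    assume "q \<in> S"
    then obtain t where t: "t \<in> S" "adj q t" using closed by blast
    then have "p = t" using common_unique[OF q(1) p(1) adj_sym[OF q(2)]] S(1) mem_N by blast
    then show False using p t by simp
  qed
  then show ?thesis using that p q by blast
qed

text \<open>Since the degree of \<open>y\<close> is at least 2, \<open>triangle_degree_less\<close>
  yields 2(d - 4) < d for the degree d of \<open>x\<close>.\<close>

lemma card_N_less_8:
  assumes "x \<in> verts G"
  shows "card (N x) < 8"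
proof -
  have "N x \<noteq> {}" using card_N[OF assms] by auto
  then obtain y where y: "adj x y" by auto
  then have "N x \<inter> N y \<noteq> {}" using triangles by fastforce
  from triangle_degree_less[OF y this]
  have less: "int (card (N y)) * (int (card (N x)) - 4) < int (card (N x))" .
  show ?thesis
  proof (rule ccontr)
    assume "\<not> card (N x) < 8"
    then have "2 * (int (card (N x)) - 4) \<le> int (card (N y)) * (int (card (N x)) - 4)"
      using card_N[OF adj_verts(2)[OF y]] by (intro mult_right_mono) auto
    then have "2 * (int (card (N x)) - 4) < int (card (N x))"
      using less by (rule le_less_trans)
    then show False using \<open>\<not> card (N x) < 8\<close> by simp
  qed
qed

text \<open>Pairs are split off by \<open>next_pair\<close> until the neighborhood is exhausted; a
  fourth pair would give degree at least 8.\<close>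

lemma N_cases:
  assumes "x \<in> verts G"
  obtains
    (2) p q where "N x = {p, q}" "adj p q"
  | (4) p q r s where "N x = {p, q, r, s}" "distinct [p, q, r, s]" "adj p q" "adj r s"
  | (6) p q r s t u where "N x = {p, q, r, s, t, u}" "distinct [p, q, r, s, t, u]"
      "adj p q" "adj r s" "adj t u"
proof -
  have "N x \<noteq> {}" using card_N[OF assms] by auto
  then obtain p q where pq: "adj p q" "adj x p" "adj x q"
    using next_pair[of "{}" x] by auto
  show ?thesis
  proof (cases "N x = {p, q}")
    case False
    obtain r s where rs: "adj r s" "adj x r" "adj x s" "r \<notin> {p, q}" "s \<notin> {p, q}"
      by (rule next_pair[of "{p, q}" x]) (use pq False adj_sym in auto)
    show ?thesis
    proof (cases "N x = {p, q, r, s}")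
      case True
      then show ?thesis using 4[of p q r s] pq rs adj_neq[OF pq(1)] adj_neq[OF rs(1)] by auto
    next
      case False
      obtain t u where tu: "adj t u" "adj x t" "adj x u" "t \<notin> {p, q, r, s}" "u \<notin> {p, q, r, s}"
        by (rule next_pair[of "{p, q, r, s}" x]) (use pq rs False adj_sym in auto)
      show ?thesis
      proof (cases "N x = {p, q, r, s, t, u}")
        case True
        then show ?thesis
          using 6[of p q r s t u] pq rs tu adj_neq[OF pq(1)] adj_neq[OF rs(1)] adj_neq[OF tu(1)] by auto
      next
        case False
        obtain v w where vw: "adj v w" "adj x v" "adj x w" "v \<notin> {p, q, r, s, t, u}" "w \<notin> {p, q, r, s, t, u}"
          by (rule next_pair[of "{p, q, r, s, t, u}" x]) (use pq rs tu False adj_sym in auto)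
        have "card {p, q, r, s, t, u, v, w} = 8"
          using rs tu vw adj_neq[OF pq(1)] adj_neq[OF rs(1)] adj_neq[OF tu(1)] adj_neq[OF vw(1)] by auto
        moreover have "card {p, q, r, s, t, u, v, w} \<le> card (N x)"
          using pq rs tu vw finite_N[OF assms] by (intro card_mono) auto
        ultimately show ?thesis using card_N_less_8[OF assms] by simp
      qed
    qed
  qed (use 2 pq in auto)
qed

section \<open>Vertices of degree 2 or 6 and friendship graphs\<close>

lemma friendship_case:
  assumes z: "z \<in> verts G" and two: "\<And>u. adj z u \<Longrightarrow> card (N u) = 2"
  shows "isomorphic G (cycle_graph 3) \<or> (\<exists>k\<in>{2, 3}. isomorphic G (friendship_graph k))"
proof -
  \<comment> \<open>A neighbor of degree 2 sees only the center \<open>z\<close> and its partner. So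
    one, two or three pairs at \<open>z\<close> already make up the whole graph.\<close>
  have leaf: "N u = {z, v} \<and> N v = {z, u}" if "adj z u" "adj z v" "adj u v" for u v
    using that two adj_verts adj_sym adj_neq[OF that(1)] adj_neq[OF that(2)]
    by (intro conjI N_eqI) auto
  from z show ?thesis
  proof (cases rule: N_cases)
    case (2 p q)
    then have "adj z p" "adj z q" by (simp_all flip: mem_N)
    then have "isomorphic G (cycle_graph 3)"
      using 2 leaf[of p q] adj_neq by (intro C3_recognition[of z p q]) auto
    then show ?thesis by blast
  next
    case (4 p q r s)
    then have adj: "adj z p" "adj z q" "adj z r" "adj z s" by (simp_all flip: mem_N)
    have "isomorphic G (friendship_graph 2)"
      using 4 adj[THEN adj_neq] leaf[OF adj(1,2)] leaf[OF adj(3,4)]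
      by (intro F2_recognition[of z p q r s]) auto
    then show ?thesis by blast
  next
    case (6 p q r s t u)
    then have adj: "adj z p" "adj z q" "adj z r" "adj z s" "adj z t" "adj z u"
      by (simp_all flip: mem_N)
    have "isomorphic G (friendship_graph 3)"
      using 6 adj[THEN adj_neq] leaf[OF adj(1,2)] leaf[OF adj(3,4)] leaf[OF adj(5,6)]
      by (intro F3_recognition[of z p q r s t u]) auto
    then show ?thesis by blast
  qed
qed

text \<open>At degree 6, \<open>triangle_degree_less\<close> says that twice the degree of any
  neighbor is below 6, so \<open>x\<close> is the center of a friendship graph.\<close>

lemma degree_6_case:
  assumes x: "x \<in> verts G" and "card (N x) = 6"
  shows "isomorphic G (cycle_graph 3) \<or> (\<exists>k\<in>{2, 3}. isomorphic G (friendship_graph k))"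
proof (rule friendship_case[OF x])
  fix u assume u: "adj x u"
  then have "N x \<inter> N u \<noteq> {}" using triangles by fastforce
  from triangle_degree_less[OF u this] assms(2) have "card (N u) < 3" by simp
  then show "card (N u) = 2" using card_N[OF adj_verts(2)[OF u]] by simp
qed

text \<open>If \<open>u\<close> had a second pair \<open>w\<close>, \<open>t\<close>, then
  \<open>triangle_matching\<close> on the edge from \<open>z\<close> to \<open>u\<close> would give
  \<open>x\<close> a common neighbor with \<open>w\<close> or \<open>t\<close>. Only
  \<open>y\<close> and \<open>z\<close> are available, and both violate the absence of
  4-cycles.\<close>

lemma degree_2_propagates:
  assumes Nx: "N x = {y, z}" "adj y z" and u: "adj z u" "u \<noteq> x" "u \<noteq> y"
  shows "card (N u) = 2"
proof (rule ccontr)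
  assume n2: "card (N u) \<noteq> 2"
  have "adj x y" "adj x z" using Nx(1) by (simp_all flip: mem_N)
  then have x: "adj z x" "adj y x" using adj_sym by blast+
  obtain v where v: "adj z v" "adj u v" using triangles u(1) by blast
  have "card {z, v} = 2" using adj_neq[OF v(1)] by simp
  then have "N u \<noteq> {z, v}" using n2 by auto
  then obtain w t where wt: "adj w t" "adj u w" "adj u t" "w \<notin> {z, v}" "t \<notin> {z, v}"
    by (rule next_pair[of "{z, v}" u, rotated]) (use u v adj_sym in auto)
  have "u \<notin> N x" unfolding Nx(1) using u adj_neq[OF u(1)] by simp
  then have "v \<noteq> x" using v(2) adj_sym by auto
  then have xv: "x \<noteq> v" by simp
  have uz: "adj u z" using u adj_sym by blast
  have neq: "w \<noteq> z" "w \<noteq> v" "t \<noteq> z" "t \<noteq> v" "w \<noteq> t"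
    using wt adj_neq[OF wt(1)] by simp_all
  obtain s where s: "adj x s" "adj w s \<or> adj t s"
    by (rule triangle_matching[OF u(1) v x(1) u(2)[symmetric] xv wt(2) neq(1,2) wt(3) neq(3-)])
  have "s \<in> N x" using s by simp
  then have yz: "s = y \<or> s = z" using Nx(1) by simp
  \<comment> \<open>\<open>s = z\<close> would put a second triangle on the edge from
    \<open>z\<close> to \<open>u\<close>; \<open>s = y\<close> would close the 4-cycle
    \<open>y\<close>, \<open>z\<close>, \<open>u\<close>, \<open>c\<close>.\<close>
  have no: False if c: "adj u c" "c \<noteq> z" "c \<noteq> v" "adj c s" for c
    using yz
  proof
    assume "s = z"
    then show False using common_unique[OF u(1) v, of c] c adj_sym by blast
  next
    assume "s = y"
    then show False
      using c4[OF c(1) uz _ Nx(2)] c adj_sym u(3) by blast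
  qed
  show False using s(2) no[OF wt(2) neq(1,2)] no[OF wt(3) neq(3,4)] by blast
qed

lemma degree_2_case:
  assumes x: "x \<in> verts G" and "card (N x) = 2"
  shows "isomorphic G (cycle_graph 3) \<or> (\<exists>k\<in>{2, 3}. isomorphic G (friendship_graph k))"
  using x
proof (cases rule: N_cases)
  case (2 p q)
  \<comment> \<open>The triangle on \<open>x\<close> is \<open>x\<close>, \<open>y\<close>,
    \<open>z\<close>, and a further neighbor \<open>u\<close> makes \<open>z\<close> the
    center.\<close>
  have *: ?thesis if Nx: "N x = {y, z}" "adj y z" and u: "adj z u" "u \<notin> {x, y}" for y z u
  proof (rule friendship_case[of z])
    show "z \<in> verts G" using u adj_verts by blast
    have "adj x y" "adj x z" using Nx(1) by (simp_all flip: mem_N)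
    then have zx: "adj z x" "adj z y" and yx: "adj y x" using Nx(2) adj_sym by blast+
    fix w assume w: "adj z w"
    have cu: "card (N u) = 2" using degree_2_propagates[OF Nx u(1)] u by simp
    obtain v where v: "adj z v" "adj u v" using triangles u(1) by blast
    have Nu: "N u = {v, z}"
      using cu v u adj_verts adj_sym adj_neq[OF v(1)] by (intro N_eqI) auto
    show "card (N w) = 2"
    proof (cases "w = x \<or> w = u")
      case False
      have "v \<noteq> y"
        using v u common_unique[OF zx(2) zx(1) yx, of u] adj_sym by blast
      show ?thesis
      proof (cases "w = y")
        case True
        \<comment> \<open>Propagation from \<open>x\<close> does not reach \<open>y\<close>, so it
          is started from \<open>u\<close>, which by now has degree 2.\<close>
        then show ?thesis
          using degree_2_propagates[OF Nu adj_sym[OF v(1)] zx(2)] u \<open>v \<noteq> y\<close> by auto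
      next
        case F: False
        then show ?thesis using degree_2_propagates[OF Nx w] False by simp
      qed
    qed (use cu assms in auto)
  qed
  have "adj x p" "adj x q" using 2(1) by (simp_all flip: mem_N)
  then have adj: "adj p x" "adj q x" using adj_sym by blast+
  show ?thesis
  proof (cases "\<exists>u. u \<notin> {x, p} \<and> adj q u \<or> u \<notin> {x, q} \<and> adj p u")
    case True
    then show ?thesis using *[of p q] *[of q p] 2 adj_sym by (auto simp: insert_commute)
  next
    case False
    then have "N p = {x, q}" "N q = {x, p}" using adj 2 adj_sym by auto
    then have "isomorphic G (cycle_graph 3)"
      using 2 adj[THEN adj_neq] adj_neq[OF 2(2)] by (intro C3_recognition[of x p q]) auto
    then show ?thesis by blast
  qed
qed (use assms in auto)

end

section \<open>The line graph of the Petersen graph\<close>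

text \<open>Both graphs are compared with one adjacency table \<open>M\<close> on list positions,
  which suits a target whose vertices are not numbers.\<close>

lemma two_labellings_isomorphic:
  assumes conn: "connected_graph G" and dist: "distinct vs" "distinct ws" "length vs = length ws"
    and sets: "vs \<noteq> []" "set vs \<subseteq> verts G" "verts F = set ws"
    and nG: "\<And>i. i < length vs \<Longrightarrow> neighborhood G (vs ! i) = (\<lambda>j. vs ! j) ` M i"
    and nF: "\<And>i. i < length ws \<Longrightarrow> neighborhood F (ws ! i) = (\<lambda>j. ws ! j) ` M i"
    and M: "\<And>i. i < length vs \<Longrightarrow> M i \<subseteq> {..<length vs}"
  shows "isomorphic G F"
proof -
  let ?n = "length vs"
  define idx where "idx = inv_into {..<?n} ((!) ws)"
  have "inj_on ((!) ws) {..<?n}"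
    using dist by (intro inj_on_nth) auto
  then have idx: "idx (ws ! i) = i" if "i < ?n" for i
    using that by (simp add: idx_def)
  show ?thesis
  proof (rule isomorphic_if_neighborhoods[OF conn, where g = "\<lambda>w. vs ! idx w"])
    have F: "\<exists>i<?n. w = ws ! i" if "w \<in> verts F" for w
      using that dist(3) sets(3) by (auto simp: in_set_conv_nth)
    show "inj_on (\<lambda>w. vs ! idx w) (verts F)"
    proof (rule inj_onI)
      fix w w' assume "w \<in> verts F" "w' \<in> verts F" "vs ! idx w = vs ! idx w'"
      then obtain i j where "i < ?n" "w = ws ! i" "j < ?n" "w' = ws ! j" "vs ! i = vs ! j"
        using F[of w] F[of w'] idx by auto
      then show "w = w'" using dist nth_eq_iff_index_eq[OF dist(1)] by simp
    qed
    show "verts F \<noteq> {}" using sets dist by auto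
    show "(\<lambda>w. vs ! idx w) ` verts F \<subseteq> verts G"
      using F idx sets(2) by (force simp: subset_iff)
    fix w assume "w \<in> verts F"
    then obtain i where i: "i < ?n" "w = ws ! i" using F by blast
    have "(\<lambda>w. vs ! idx w) ` neighborhood F w = (\<lambda>j. vs ! idx (ws ! j)) ` M i"
      using i nF dist(3) by (simp add: image_image)
    also have "\<dots> = (\<lambda>j. vs ! j) ` M i"
      using M[OF i(1)] idx by (intro image_cong) auto
    finally show "neighborhood G (vs ! idx w) = (\<lambda>w. vs ! idx w) ` neighborhood F w"
      using i idx nG by simp
  qed
qed

section \<open>Explicit neighborhoods in the Petersen graph and its line graph\<close>

lemma verts_petersen:
  "verts petersen_graph =
    {{0, 1}, {2, 3}, {2, 4}, {3, 4}, {0, 4}, {1, 4}, {1, 3}, {0, 3}, {1, 2}, {0, 2}}" (is "_ = ?P")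
proof -
  have "{x, y} \<in> ?P" if "x \<in> {0, 1, 2, 3, 4}" "y \<in> {0, 1, 2, 3, 4}" "x \<noteq> y" for x y :: nat
    using that by (auto simp: doubleton_eq_iff)
  note pair = this
  have five: "{0..<5} = {0, 1, 2, 3, 4 :: nat}" by auto
  have "{S. S \<subseteq> {0..<5} \<and> card S = 2} = ?P"
  proof (intro equalityI subsetI)
    fix S :: "nat set" assume "S \<in> {S. S \<subseteq> {0..<5} \<and> card S = 2}"
    then have S: "S \<subseteq> {0..<5}" "card S = 2" by simp_all
    then obtain x y where xy: "S = {x, y}" "x \<noteq> y" unfolding card_2_iff by blast
    then have "x \<in> {0..<5}" "y \<in> {0..<5}" using S(1) by simp_all
    then show "S \<in> ?P" unfolding xy(1) five by (rule pair[OF _ _ xy(2)])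
  next
    fix S assume "S \<in> ?P"
    then show "S \<in> {S. S \<subseteq> {0..<5} \<and> card S = 2}"
      unfolding insert_iff empty_iff by (elim disjE) simp_all
  qed
  then show ?thesis unfolding petersen_graph_def Let_def by simp
qed

lemma neighborhood_petersen:
  assumes "S \<in> verts petersen_graph"
  shows "neighborhood petersen_graph S = {S' \<in> verts petersen_graph. S \<inter> S' = {}}"
  using assms by (auto simp: neighborhood_def petersen_graph_def Let_def doubleton_eq_iff)

lemma neighborhood_line_graph:
  assumes "simple_graph G" "{u, v} \<in> edges G"
  shows "neighborhood (line_graph G) {u, v} =
    (\<lambda>w. {u, w}) ` (neighborhood G u - {v}) \<union> (\<lambda>w. {v, w}) ` (neighborhood G v - {u})"
proof -
  have pair: "\<exists>w. e = {x, w} \<and> w \<in> neighborhood G x" if e: "e \<in> edges G" "x \<in> e" for e x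
  proof -
    have "card e = 2" "e \<subseteq> verts G" using assms(1) e(1) by (auto simp: simple_graph_def)
    then obtain y where "e = {x, y}" using e(2) unfolding card_2_iff by blast
    then show ?thesis using e \<open>e \<subseteq> verts G\<close> by (auto simp: neighborhood_def)
  qed
  have "u \<noteq> v" using assms by (auto simp: simple_graph_def)
  have "neighborhood (line_graph G) {u, v} = {e \<in> edges G. e \<noteq> {u, v} \<and> (u \<in> e \<or> v \<in> e)}"
    using assms(2) by (auto simp: neighborhood_def line_graph_def doubleton_eq_iff)
  also have "\<dots> = (\<lambda>w. {u, w}) ` (neighborhood G u - {v}) \<union> (\<lambda>w. {v, w}) ` (neighborhood G v - {u})"
  proof (intro equalityI subsetI)
    fix e assume e: "e \<in> {e \<in> edges G. e \<noteq> {u, v} \<and> (u \<in> e \<or> v \<in> e)}"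
    then consider "u \<in> e" | "v \<in> e" by blast
    then show "e \<in> (\<lambda>w. {u, w}) ` (neighborhood G u - {v}) \<union> (\<lambda>w. {v, w}) ` (neighborhood G v - {u})"
    proof cases
      case 1
      then show ?thesis using pair[of e u] e by auto
    next
      case 2
      then show ?thesis using pair[of e v] e by (auto simp: insert_commute)
    qed
  next
    fix e assume "e \<in> (\<lambda>w. {u, w}) ` (neighborhood G u - {v}) \<union> (\<lambda>w. {v, w}) ` (neighborhood G v - {u})"
    then show "e \<in> {e \<in> edges G. e \<noteq> {u, v} \<and> (u \<in> e \<or> v \<in> e)}"
      using \<open>u \<noteq> v\<close> by (auto simp: neighborhood_def doubleton_eq_iff)
  qed
  finally show ?thesis .
qed

lemma simple_petersen: "simple_graph petersen_graph"
proof -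
  have "card {S, S'} = 2" if "card S = 2" "S \<inter> S' = {}" for S S' :: "nat set"
    using that by (cases "S = S'") auto
  then show ?thesis
    by (auto simp: simple_graph_def petersen_graph_def Let_def)
qed

lemma neighborhood_petersen_explicit:
  "neighborhood petersen_graph {0, 1} = {{2, 3}, {2, 4}, {3, 4}}"
  "neighborhood petersen_graph {2, 3} = {{0, 1}, {0, 4}, {1, 4}}"
  "neighborhood petersen_graph {2, 4} = {{0, 1}, {1, 3}, {0, 3}}"
  "neighborhood petersen_graph {3, 4} = {{0, 1}, {1, 2}, {0, 2}}"
  "neighborhood petersen_graph {0, 4} = {{2, 3}, {1, 3}, {1, 2}}"
  "neighborhood petersen_graph {1, 4} = {{2, 3}, {0, 3}, {0, 2}}"
  "neighborhood petersen_graph {1, 3} = {{2, 4}, {0, 4}, {0, 2}}"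
  "neighborhood petersen_graph {0, 3} = {{2, 4}, {1, 4}, {1, 2}}"
  "neighborhood petersen_graph {1, 2} = {{3, 4}, {0, 4}, {0, 3}}"
  "neighborhood petersen_graph {0, 2} = {{3, 4}, {1, 4}, {1, 3}}"
  by (auto simp: neighborhood_petersen verts_petersen)

text \<open>
  The edges at the vertex \<open>{0, 1}\<close> come first, followed by the six further edges at its neighbors
  and by the hexagon formed by the remaining vertices. This is the order of the vertices
  \<open>a, b, c, a1, a2, b1, b2, c1, c2, w1, w2, v1, v2, u1, u2\<close> below.
\<close>

definition H_labels :: "nat set set list" where
  "H_labels =
    [{{0, 1}, {2, 3}}, {{0, 1}, {2, 4}}, {{0, 1}, {3, 4}}, {{2, 3}, {0, 4}},
     {{2, 3}, {1, 4}}, {{2, 4}, {1, 3}}, {{2, 4}, {0, 3}}, {{3, 4}, {1, 2}},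
     {{3, 4}, {0, 2}}, {{0, 4}, {1, 3}}, {{1, 4}, {0, 3}}, {{0, 4}, {1, 2}},
     {{1, 4}, {0, 2}}, {{1, 3}, {0, 2}}, {{0, 3}, {1, 2}}]"

text \<open>The entries are positions in \<open>H_labels\<close>; \<open>H_recognition\<close> reads
  the same table against the vertices of \<open>G\<close>.\<close>

definition H_neighbors :: "nat list list" where
  "H_neighbors =
    [[1, 2, 3, 4], [0, 2, 5, 6], [0, 1, 7, 8], [0, 4, 9, 11], [0, 3, 10, 12],
     [1, 6, 9, 13], [1, 5, 10, 14], [2, 8, 11, 14], [2, 7, 12, 13], [3, 5, 11, 13],
     [4, 6, 12, 14], [3, 7, 9, 14], [4, 8, 10, 13], [5, 8, 9, 12], [6, 7, 10, 11]]"

lemma neighborhood_H_graph: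
  assumes "v \<in> neighborhood petersen_graph u"
  shows "neighborhood H_graph {u, v} =
    (\<lambda>w. {u, w}) ` (neighborhood petersen_graph u - {v}) \<union>
    (\<lambda>w. {v, w}) ` (neighborhood petersen_graph v - {u})"
  unfolding H_graph_def using assms
  by (intro neighborhood_line_graph simple_petersen) (simp add: neighborhood_def)

lemma H_neighbors_correct:
  assumes "i < 15"
  shows "neighborhood H_graph (H_labels ! i) = (\<lambda>j. H_labels ! j) ` set (H_neighbors ! i)"
proof -
  have "i = 0 \<or> i = 1 \<or> i = 2 \<or> i = 3 \<or> i = 4 \<or> i = 5 \<or> i = 6 \<or> i = 7 \<or> i = 8 \<or> i = 9 \<or> i = 10 \<or> i = 11 \<or> i = 12 \<or> i = 13 \<or> i = 14"
    using assms by presburger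
  then show ?thesis
    by (elim disjE; simp add: H_labels_def H_neighbors_def neighborhood_H_graph
      neighborhood_petersen_explicit doubleton_eq_iff insert_Diff_if del: One_nat_def; intro equalityI; simp add: doubleton_eq_iff)
qed

lemma verts_H_graph: "verts H_graph = set H_labels"
proof
  show "set H_labels \<subseteq> verts H_graph"
  proof -
    have "{u, v} \<in> verts H_graph" if "v \<in> neighborhood petersen_graph u" for u v
      using that by (simp add: H_graph_def line_graph_def neighborhood_def)
    then show ?thesis
      by (simp add: H_labels_def neighborhood_petersen_explicit del: One_nat_def)
  qed
  show "verts H_graph \<subseteq> set H_labels"
  proof
    fix e assume "e \<in> verts H_graph"
    then obtain S S' where e: "e = {S, S'}" "S \<in> verts petersen_graph" "S' \<in> neighborhood petersen_graph S"
      by (auto simp: H_graph_def line_graph_def petersen_graph_def Let_def neighborhood_def)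
    from e(2) have "\<forall>S'\<in>neighborhood petersen_graph S. {S, S'} \<in> set H_labels"
      unfolding verts_petersen insert_iff empty_iff
      by (elim disjE; simp add: neighborhood_petersen_explicit H_labels_def doubleton_eq_iff
        del: One_nat_def)
    then show "e \<in> set H_labels" using e by blast
  qed
qed

lemma distinct_H_labels: "distinct H_labels"
  by (simp add: H_labels_def doubleton_eq_iff del: One_nat_def)

lemma (in pos_curved_c4_free) H_recognition:
  assumes dist: "distinct [a, b, c, a1, a2, b1, b2, c1, c2, w1, w2, v1, v2, u1, u2]"
    and N: "N a = {b, c, a1, a2}" "N b = {a, c, b1, b2}" "N c = {a, b, c1, c2}"
      "N a1 = {a, a2, w1, v1}" "N a2 = {a, a1, w2, v2}" "N b1 = {b, b2, w1, u1}"
      "N b2 = {b, b1, w2, u2}" "N c1 = {c, c2, v1, u2}" "N c2 = {c, c1, v2, u1}"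
      "N w1 = {a1, b1, v1, u1}" "N w2 = {a2, b2, v2, u2}" "N v1 = {a1, c1, w1, u2}"
      "N v2 = {a2, c2, w2, u1}" "N u1 = {b1, c2, w1, v2}" "N u2 = {b2, c1, w2, v1}"
  shows "isomorphic G H_graph"
proof (rule two_labellings_isomorphic[OF conn dist distinct_H_labels])
  let ?vs = "[a, b, c, a1, a2, b1, b2, c1, c2, w1, w2, v1, v2, u1, u2]"
  show len: "length ?vs = length H_labels" by (simp add: H_labels_def)
  have "adj a b" "adj c c1" "adj c c2" "adj a a1" "adj a a2" "adj b b1" "adj b b2"
    "adj w1 v1" "adj w2 v2" "adj b1 u1" "adj b2 u2"
    using N by (simp_all flip: mem_N)
  then show "set ?vs \<subseteq> verts G" using adj_verts by simp
  show "verts H_graph = set H_labels" by (rule verts_H_graph)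
  fix i
  {
    assume "i < length H_labels"
    then show "neighborhood H_graph (H_labels ! i) = (\<lambda>j. H_labels ! j) ` set (H_neighbors ! i)"
      by (intro H_neighbors_correct) (simp add: H_labels_def)
  }
  assume "i < length ?vs"
  then have i: "i = 0 \<or> i = 1 \<or> i = 2 \<or> i = 3 \<or> i = 4 \<or> i = 5 \<or> i = 6 \<or> i = 7 \<or> i = 8 \<or>
    i = 9 \<or> i = 10 \<or> i = 11 \<or> i = 12 \<or> i = 13 \<or> i = 14"
    unfolding list.size by presburger
  then show "set (H_neighbors ! i) \<subseteq> {..<length ?vs}"
    by (elim disjE; simp add: H_neighbors_def del: One_nat_def)
  from i show "N (?vs ! i) = (\<lambda>j. ?vs ! j) ` set (H_neighbors ! i)"
    by (elim disjE; simp add: H_neighbors_def N del: One_nat_def)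
qed simp

context pos_curved_triangulated
begin

section \<open>Local structure at vertices of degree 4\<close>

lemma triangle_neighborhood:
  assumes card: "card (N x) = 4" and adj: "adj x y" "adj x z" "adj y z"
  obtains p q where "N x = {y, z, p, q}" "distinct [y, z, p, q]" "adj p q"
proof -
  have "card {y, z} \<le> 2" by (simp add: card_insert_if)
  then have "N x \<noteq> {y, z}" using card by auto
  then obtain p q where pq: "adj p q" "adj x p" "adj x q" "p \<notin> {y, z}" "q \<notin> {y, z}"
    by (rule next_pair[of "{y, z}" x, rotated]) (use adj adj_sym in auto)
  have "distinct [y, z, p, q]"
    using pq adj_neq[OF pq(1)] adj_neq[OF adj(3)] by auto
  moreover from this have "N x = {y, z, p, q}"
    using adj pq adj_verts card by (intro N_eqI) auto
  ultimately show ?thesis using that pq by blast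
qed

text \<open>Uniqueness of partners makes the two pairs disjoint, so they fill a neighborhood of size
  4.\<close>

lemma two_triangles:
  assumes card: "card (N x) = 4"
    and p: "adj x p" "adj x p'" "adj p p'" and q: "adj x q" "adj x q'" "adj q q'"
    and neq: "q \<noteq> p" "q \<noteq> p'"
  shows "N x = {p, p', q, q'} \<and> distinct [p, p', q, q']"
proof -
  have "q' \<noteq> p" "q' \<noteq> p'"
    using common_unique[OF p, of q] common_unique[OF p(2,1) adj_sym[OF p(3)], of q] q neq adj_sym
    by blast+
  then have d: "distinct [p, p', q, q']"
    using neq adj_neq[OF p(3)] adj_neq[OF q(3)] by auto
  then show ?thesis
    using p q adj_verts card by (intro conjI N_eqI) auto
qed

text \<open>The neighborhood consists of two matched pairs, so two of any three neighbors are
  partners.\<close>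

lemma claw_free:
  assumes card: "card (N x) = 4" and adj: "adj x p" "adj x q" "adj x r"
    and neq: "p \<noteq> q" "p \<noteq> r" "q \<noteq> r"
  shows "adj p q \<or> adj p r \<or> adj q r"
proof (rule ccontr)
  assume no: "\<not> ?thesis"
  obtain p' where p': "adj x p'" "adj p p'" using triangles adj(1) by blast
  obtain q' where q': "adj x q'" "adj q q'" using triangles adj(2) by blast
  obtain r' where r': "adj x r'" "adj r r'" using triangles adj(3) by blast
  have "q \<noteq> p'" "r \<noteq> p'" "r \<noteq> q'" using p' q' r' no adj_sym by blast+
  then have "N x = {p, p', q, q'}"
    using two_triangles[OF card adj(1) p' adj(2) q'] neq by blast
  then have "r \<in> {p, p', q, q'}" using adj(3) by (simp flip: mem_N)
  then show False using neq \<open>r \<noteq> p'\<close> \<open>r \<noteq> q'\<close> by simp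
qed

text \<open>A neighbor shared by \<open>x\<close> and \<open>y\<close> other than \<open>z\<close>
  would give their edge a second triangle; an edge from \<open>u\<close> to \<open>v\<close> would
  close the 4-cycle \<open>u\<close>, \<open>x\<close>, \<open>y\<close>, \<open>v\<close>.\<close>

lemma triangle_cross:
  assumes tri: "adj x y" "adj x z" "adj y z"
    and u: "adj x u" "u \<noteq> y" "u \<noteq> z" and v: "adj y v" "v \<noteq> x" "v \<noteq> z"
  shows "\<not> adj u v" "u \<noteq> v" "\<not> adj x v" "\<not> adj y u"
proof -
  show xv: "\<not> adj x v" using common_unique[OF tri, of v] v by blast
  show "\<not> adj y u" using common_unique[OF tri, of u] u by blast
  show "u \<noteq> v" using xv u by blast
  show "\<not> adj u v" using c4[of u x v y] tri(1) u v adj_sym by blast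
qed

text \<open>An edge from \<open>w\<close> to \<open>x\<close> or \<open>y\<close> would close a
  4-cycle through the edge from \<open>x\<close> to \<open>y\<close> and through \<open>v\<close> or
  \<open>u\<close>, respectively.\<close>

lemma triangle_join:
  assumes tri: "adj x y" "adj x z" "adj y z"
    and u: "adj x u" "u \<noteq> y" "u \<noteq> z" and v: "adj y v" "v \<noteq> x" "v \<noteq> z"
    and w: "adj u w" "adj v w"
  shows "w \<noteq> x" "w \<noteq> y" "\<not> adj x w" "\<not> adj y w"
proof -
  note cross = triangle_cross[OF tri u v]
  show wx: "w \<noteq> x" "w \<noteq> y" using cross(3,4) w adj_sym by blast+
  show "\<not> adj x w" using c4[of x w y v] tri(1) v w(2) wx adj_sym by blast
  show "\<not> adj y w" using c4[of y w x u] tri(1) u w(1) wx adj_sym by blast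
qed

text \<open>Let \<open>R\<close> mean having a common neighbor. By \<open>triangle_matching\<close>
  in both directions, \<open>R\<close> leaves no vertex isolated between the outer pairs of
  \<open>x\<close> and \<open>y\<close>. On two plus two vertices this yields a perfect matching,
  and \<open>v\<close>, \<open>v'\<close> are named to fit it.\<close>

lemma matched_neighbors:
  assumes card: "card (N y) = 4" and tri: "adj x y" "adj x z" "adj y z"
    and u: "adj x u" "u \<noteq> y" "u \<noteq> z" and u': "adj x u'" "u' \<noteq> y" "u' \<noteq> z" "u \<noteq> u'"
  obtains v v' w w' where "N y = {x, z, v, v'}" "distinct [x, z, v, v']" "adj v v'"
    "adj u w" "adj v w" "adj u' w'" "adj v' w'"
proof -
  obtain v v' where v: "N y = {x, z, v, v'}" "distinct [x, z, v, v']" "adj v v'"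
    using triangle_neighborhood[OF card adj_sym[OF tri(1)] tri(3,2)] .
  have yv: "adj y v" "v \<noteq> x" "v \<noteq> z" and yv': "adj y v'" "v' \<noteq> x" "v' \<noteq> z" and vv: "v \<noteq> v'"
    using v(1,2) by (auto simp flip: mem_N)
  define R where "R s t \<longleftrightarrow> (\<exists>w. adj s w \<and> adj t w)" for s t
  have "R u v \<or> R u v'"
    using triangle_matching[OF tri u yv yv' vv] unfolding R_def by metis
  moreover have "R u' v \<or> R u' v'"
    using triangle_matching[OF tri u'(1-3) yv yv' vv] unfolding R_def by metis
  moreover have "R u v \<or> R u' v"
    using triangle_matching[OF adj_sym[OF tri(1)] tri(3,2) yv u u'] unfolding R_def by metis
  moreover have "R u v' \<or> R u' v'"
    using triangle_matching[OF adj_sym[OF tri(1)] tri(3,2) yv' u u'] unfolding R_def by metis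
  ultimately consider "R u v" "R u' v'" | "R u v'" "R u' v" by blast
  then show ?thesis
  proof cases
    case 1
    then show ?thesis using that[OF v] unfolding R_def by blast
  next
    case 2
    have "N y = {x, z, v', v}" "distinct [x, z, v', v]" using v by auto
    then show ?thesis using that[OF _ _ adj_sym[OF v(3)]] 2 unfolding R_def by blast
  qed
qed

text \<open>Fix a triangle \<open>a\<close>, \<open>b\<close>, \<open>c\<close> with outer pairs
  \<open>a1 a2\<close>, \<open>b1 b2\<close>, \<open>c1 c2\<close>. The orders of the last two pairs
  are chosen so that \<open>w1\<close>, \<open>w2\<close> join equal indices of \<open>a\<close> and
  \<open>b\<close>, and \<open>v1\<close>, \<open>v2\<close> those of \<open>a\<close> and
  \<open>c\<close>. It remains open whether \<open>b\<close> and \<open>c\<close> are matched in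
  parallel or crossed; only the crossed matching survives, and then all neighborhoods are
  determined.\<close>

lemma H_case:
  assumes reg: "\<And>x. x \<in> verts G \<Longrightarrow> card (N x) = 4"
  shows "isomorphic G H_graph"
proof -
  have deg: "card (N x) = 4" if "adj x y" for x y
    using reg adj_verts(1)[OF that] .
  have deg': "card (N x) = 4" if "adj y x" for x y
    using reg adj_verts(2)[OF that] .
  obtain a where a: "a \<in> verts G" using conn by (auto simp: connected_graph_def)
  then have "N a \<noteq> {}" using reg[OF a] by auto
  then obtain b where ab: "adj a b" by auto
  then obtain c where ac: "adj a c" and bc: "adj b c" using triangles by blast
  obtain a1 a2 where Na: "N a = {b, c, a1, a2}" "distinct [b, c, a1, a2]" "adj a1 a2"
    using triangle_neighborhood[OF reg[OF a] ab ac bc] .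
  have a1: "adj a a1" "a1 \<noteq> b" "a1 \<noteq> c" and a2: "adj a a2" "a2 \<noteq> b" "a2 \<noteq> c" "a1 \<noteq> a2"
    using Na(1,2) by (auto simp flip: mem_N)
  obtain b1 b2 w1 w2 where Nb: "N b = {a, c, b1, b2}" "distinct [a, c, b1, b2]" "adj b1 b2"
    and w1: "adj a1 w1" "adj b1 w1" and w2: "adj a2 w2" "adj b2 w2"
    using matched_neighbors[OF deg[OF bc] ab ac bc a1 a2] .
  obtain c1 c2 v1 v2 where Nc: "N c = {a, b, c1, c2}" "distinct [a, b, c1, c2]" "adj c1 c2"
    and v1: "adj a1 v1" "adj c1 v1" and v2: "adj a2 v2" "adj c2 v2"
    using matched_neighbors[OF deg'[OF bc] ac ab adj_sym[OF bc] a1(1,3,2) a2(1,3,2,4)] .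
  have b1: "adj b b1" "b1 \<noteq> a" "b1 \<noteq> c" and b2: "adj b b2" "b2 \<noteq> a" "b2 \<noteq> c" "b1 \<noteq> b2"
    using Nb(1,2) by (auto simp flip: mem_N)
  have c1: "adj c c1" "c1 \<noteq> a" "c1 \<noteq> b" and c2: "adj c c2" "c2 \<noteq> a" "c2 \<noteq> b" "c1 \<noteq> c2"
    using Nc(1,2) by (auto simp flip: mem_N)
  note cb = adj_sym[OF bc] and ba = adj_sym[OF ab] and ca = adj_sym[OF ac]
  note ab11 = triangle_cross[OF ab ac bc a1 b1]
  note ab12 = triangle_cross[OF ab ac bc a1 b2(1-3)]
  note ab21 = triangle_cross[OF ab ac bc a2(1-3) b1]
  note ab22 = triangle_cross[OF ab ac bc a2(1-3) b2(1-3)]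
  note ac11 = triangle_cross[OF ac ab cb a1(1,3,2) c1]
  note ac12 = triangle_cross[OF ac ab cb a1(1,3,2) c2(1-3)]
  note ac21 = triangle_cross[OF ac ab cb a2(1,3,2) c1]
  note ac22 = triangle_cross[OF ac ab cb a2(1,3,2) c2(1-3)]
  note bc11 = triangle_cross[OF bc ba ca b1(1,3,2) c1(1,3,2)]
  note bc12 = triangle_cross[OF bc ba ca b1(1,3,2) c2(1,3,2)]
  note bc21 = triangle_cross[OF bc ba ca b2(1,3,2) c1(1,3,2)]
  note bc22 = triangle_cross[OF bc ba ca b2(1,3,2) c2(1,3,2)]
  note jw1 = triangle_join[OF ab ac bc a1 b1 w1] and jw2 = triangle_join[OF ab ac bc a2(1-3) b2(1-3) w2]
  note jv1 = triangle_join[OF ac ab cb a1(1,3,2) c1 v1]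
    and jv2 = triangle_join[OF ac ab cb a2(1,3,2) c2(1-3) v2]
  have no_claw: False
    if "adj s p" "adj s q" "adj s r" "\<not> adj p q" "\<not> adj p r" "\<not> adj q r"
      "p \<noteq> q" "p \<noteq> r" "q \<noteq> r" for s p q r
    using claw_free[OF deg[OF that(1)] that(1-3,7-9)] that(4-6) by blast
  \<comment> \<open>If equal, this vertex would be adjacent to the pairwise nonadjacent
    \<open>a1\<close>, \<open>b1\<close>, \<open>c1\<close>.\<close>
  have "w1 \<noteq> v1"
    using no_claw[of w1 a1 b1 c1, OF _ _ _ ab11(1) ac11(1) bc11(1) ab11(2) ac11(2) bc11(2)] w1 v1
    by (auto dest: adj_sym)
  \<comment> \<open>Among the neighbors \<open>a\<close>, \<open>w1\<close>, \<open>v1\<close> of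
    \<open>a1\<close>, the vertex \<open>a\<close> is adjacent to neither of the others, so these
    are adjacent. The same two arguments give the later edges between joins.\<close>
  then have wv1: "adj w1 v1"
    using no_claw[OF adj_sym[OF a1(1)] w1(1) v1(1)] jw1 jv1 by blast
  have "w2 \<noteq> v2"
    using no_claw[of w2 a2 b2 c2, OF _ _ _ ab22(1) ac22(1) bc22(1) ab22(2) ac22(2) bc22(2)] w2 v2
    by (auto dest: adj_sym)
  then have wv2: "adj w2 v2"
    using no_claw[OF adj_sym[OF a2(1)] w2(1) v2(1)] jw2 jv2 by blast
  \<comment> \<open>The matching brings its own order of the outer pair of \<open>c\<close>, hence
    the fresh names to be compared with \<open>c1\<close>, \<open>c2\<close>.\<close>
  obtain d1 d2 u1 u2 where Nc': "N c = {b, a, d1, d2}" "distinct [b, a, d1, d2]"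
    and u: "adj b1 u1" "adj d1 u1" "adj b2 u2" "adj d2 u2"
    using matched_neighbors[OF deg'[OF bc] bc ba ca b1(1,3,2) b2(1,3,2,4)] .
  have "d1 \<in> N c" "d2 \<in> N c" unfolding Nc'(1) by simp_all
  then have "d1 \<in> {c1, c2}" "d2 \<in> {c1, c2}" using Nc'(2) unfolding Nc(1) by auto
  then have "d1 = c1 \<and> d2 = c2 \<or> d1 = c2 \<and> d2 = c1" using Nc'(2) by auto
  \<comment> \<open>In the parallel case \<open>w1\<close>, \<open>v1\<close>, \<open>u1\<close> are
    pairwise adjacent. The edge from \<open>w1\<close> to \<open>v1\<close> then lies in triangles
    with \<open>a1\<close> and with \<open>u1\<close>, so \<open>a1 = u1\<close> would be adjacent
    to \<open>b1\<close>.\<close>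
  moreover have "\<not> (d1 = c1 \<and> d2 = c2)"
  proof
    assume "d1 = c1 \<and> d2 = c2"
    with u have u1: "adj b1 u1" "adj c1 u1" by simp_all
    note ju1 = triangle_join[OF bc ba ca b1(1,3,2) c1(1,3,2) u1]
    have "w1 \<noteq> u1"
    using no_claw[of w1 a1 b1 c1, OF _ _ _ ab11(1) ac11(1) bc11(1) ab11(2) ac11(2) bc11(2)] w1 u1
    by (auto dest: adj_sym)
    then have wu: "adj w1 u1"
      using no_claw[OF adj_sym[OF b1(1)] w1(2) u1(1)] jw1 ju1 by blast
    have "v1 \<noteq> u1"
    using no_claw[of v1 a1 b1 c1, OF _ _ _ ab11(1) ac11(1) bc11(1) ab11(2) ac11(2) bc11(2)] v1 u1
    by (auto dest: adj_sym)
    then have vu: "adj v1 u1"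
      using no_claw[OF adj_sym[OF c1(1)] v1(2) u1(2)] jv1 ju1 by blast
    have "a1 = u1"
      using common_unique[OF wv1 wu vu] w1(1) v1(1) adj_sym by blast
    then show False using u1(1) ab11(1) adj_sym by blast
  qed
  \<comment> \<open>Crossing produces the closed walk
    \<open>a1 w1 b1 u1 c2 v2 a2 w2 b2 u2 c1 v1\<close>, which corresponds to the hexagon in the
    Petersen graph left by a vertex and its neighbors.\<close>
  ultimately have u1: "adj b1 u1" "adj c2 u1" and u2: "adj b2 u2" "adj c1 u2" using u by auto
  note ju1 = triangle_join[OF bc ba ca b1(1,3,2) c2(1,3,2) u1]
    and ju2 = triangle_join[OF bc ba ca b2(1,3,2) c1(1,3,2) u2]
  have "w1 \<noteq> u1"
    using no_claw[of w1 a1 b1 c2, OF _ _ _ ab11(1) ac12(1) bc12(1) ab11(2) ac12(2) bc12(2)] w1 u1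
    by (auto dest: adj_sym)
  then have wu1: "adj w1 u1"
    using no_claw[OF adj_sym[OF b1(1)] w1(2) u1(1)] jw1 ju1 by blast
  have "w2 \<noteq> u2"
    using no_claw[of w2 a2 b2 c1, OF _ _ _ ab22(1) ac21(1) bc21(1) ab22(2) ac21(2) bc21(2)] w2 u2
    by (auto dest: adj_sym)
  then have wu2: "adj w2 u2"
    using no_claw[OF adj_sym[OF b2(1)] w2(2) u2(1)] jw2 ju2 by blast
  have "v1 \<noteq> u2"
    using no_claw[of v1 a1 b2 c1, OF _ _ _ ab12(1) ac11(1) bc21(1) ab12(2) ac11(2) bc21(2)] v1 u2
    by (auto dest: adj_sym)
  then have vu1: "adj v1 u2"
    using no_claw[OF adj_sym[OF c1(1)] v1(2) u2(2)] jv1 ju2 by blast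
  have "v2 \<noteq> u1"
    using no_claw[of v2 a2 b1 c2, OF _ _ _ ab21(1) ac22(1) bc12(1) ab21(2) ac22(2) bc12(2)] v2 u1
    by (auto dest: adj_sym)
  then have vu2: "adj v2 u1"
    using no_claw[OF adj_sym[OF c2(1)] v2(2) u1(2)] jv2 ju1 by blast
  note sym = adj_sym[OF a1(1)] adj_sym[OF a2(1)] adj_sym[OF b1(1)] adj_sym[OF b2(1)]
    adj_sym[OF c1(1)] adj_sym[OF c2(1)] w1[THEN adj_sym] w2[THEN adj_sym] v1[THEN adj_sym]
    v2[THEN adj_sym] u1[THEN adj_sym] u2[THEN adj_sym] adj_sym[OF wv1] adj_sym[OF wv2]
    adj_sym[OF wu1] adj_sym[OF wu2] adj_sym[OF vu1] adj_sym[OF vu2]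
    adj_sym[OF Na(3)] adj_sym[OF Nb(3)] adj_sym[OF Nc(3)]
  \<comment> \<open>Two triangles are now known at every remaining vertex, and
    \<open>two_triangles\<close> turns them into its full neighborhood.\<close>
  have Na1: "N a1 = {a, a2, w1, v1} \<and> distinct [a, a2, w1, v1]"
    by (rule two_triangles[OF deg'[OF a1(1)] sym(1) Na(3) a2(1) w1(1) v1(1) wv1])
      (use jw1(1) ab21(1) w1(2) adj_sym in blast)+
  have Na2: "N a2 = {a, a1, w2, v2} \<and> distinct [a, a1, w2, v2]"
    by (rule two_triangles[OF deg'[OF a2(1)] sym(2) adj_sym[OF Na(3)] a1(1) w2(1) v2(1) wv2])
      (use jw2(1) ab12(1) w2(2) adj_sym in blast)+
  have Nb1: "N b1 = {b, b2, w1, u1} \<and> distinct [b, b2, w1, u1]"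
    by (rule two_triangles[OF deg'[OF b1(1)] sym(3) Nb(3) b2(1) w1(2) u1(1) wu1])
      (use jw1(2) ab12(1) w1(1) adj_sym in blast)+
  have Nb2: "N b2 = {b, b1, w2, u2} \<and> distinct [b, b1, w2, u2]"
    by (rule two_triangles[OF deg'[OF b2(1)] sym(4) adj_sym[OF Nb(3)] b1(1) w2(2) u2(1) wu2])
      (use jw2(2) ab21(1) w2(1) adj_sym in blast)+
  have Nc1: "N c1 = {c, c2, v1, u2} \<and> distinct [c, c2, v1, u2]"
    by (rule two_triangles[OF deg'[OF c1(1)] sym(5) Nc(3) c2(1) v1(2) u2(2) vu1])
      (use jv1(2) ac12(1) v1(1) adj_sym in blast)+
  have Nc2: "N c2 = {c, c1, v2, u1} \<and> distinct [c, c1, v2, u1]"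
    by (rule two_triangles[OF deg'[OF c2(1)] sym(6) adj_sym[OF Nc(3)] c1(1) v2(2) u1(2) vu2])
      (use jv2(2) ac21(1) v2(1) adj_sym in blast)+
  have Nw1: "N w1 = {a1, v1, b1, u1} \<and> distinct [a1, v1, b1, u1]"
    by (rule two_triangles[OF deg[OF wv1] adj_sym[OF w1(1)] wv1 v1(1) adj_sym[OF w1(2)] wu1 u1(1)])
      (use ab11(2) bc11(1) v1(2) adj_sym in blast)+
  have Nw2: "N w2 = {a2, v2, b2, u2} \<and> distinct [a2, v2, b2, u2]"
    by (rule two_triangles[OF deg[OF wv2] adj_sym[OF w2(1)] wv2 v2(1) adj_sym[OF w2(2)] wu2 u2(1)])
      (use ab22(2) bc22(1) v2(2) adj_sym in blast)+
  have Nv1: "N v1 = {a1, w1, c1, u2} \<and> distinct [a1, w1, c1, u2]"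
    by (rule two_triangles[OF deg[OF vu1] adj_sym[OF v1(1)] adj_sym[OF wv1] w1(1) adj_sym[OF v1(2)] vu1 u2(2)])
      (use ac11(2) bc11(1) w1(2) adj_sym in blast)+
  have Nv2: "N v2 = {a2, w2, c2, u1} \<and> distinct [a2, w2, c2, u1]"
    by (rule two_triangles[OF deg[OF vu2] adj_sym[OF v2(1)] adj_sym[OF wv2] w2(1) adj_sym[OF v2(2)] vu2 u1(2)])
      (use ac22(2) bc22(1) w2(2) adj_sym in blast)+
  have Nu1: "N u1 = {b1, w1, c2, v2} \<and> distinct [b1, w1, c2, v2]"
    by (rule two_triangles[OF deg'[OF wu1] adj_sym[OF u1(1)] adj_sym[OF wu1] w1(2) adj_sym[OF u1(2)] adj_sym[OF vu2] v2(2)])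
      (use bc12(2) ac12(1) w1(1) adj_sym in blast)+
  have Nu2: "N u2 = {b2, w2, c1, v1} \<and> distinct [b2, w2, c1, v1]"
    by (rule two_triangles[OF deg'[OF wu2] adj_sym[OF u2(1)] adj_sym[OF wu2] w2(2) adj_sym[OF u2(2)] adj_sym[OF vu1] v1(2)])
      (use bc21(2) ac21(1) w2(1) adj_sym in blast)+
  \<comment> \<open>Such a coincidence would make a corner of the central triangle adjacent to an
    outer neighbor of another corner.\<close>
  have far: "a \<noteq> u1" "a \<noteq> u2" "b \<noteq> v1" "b \<noteq> v2" "c \<noteq> w1" "c \<noteq> w2"
    using ab11(3) u1(1) ab12(3) u2(1) ab11(4) v1(1) ab21(4) v2(1) ac11(4) w1(1) ac21(4) w2(1) adj_sym
    by metis+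
  \<comment> \<open>Equal joins would close a 4-cycle, such as \<open>b\<close>, \<open>b1\<close>,
    \<open>w1\<close>, \<open>b2\<close>.\<close>
  have pairs: "w1 \<noteq> w2" "v1 \<noteq> v2" "u1 \<noteq> u2"
    using c4[OF adj_sym[OF w1(2)] _ b1(1) b2(1,4)] w2(2) jw1(2)
      c4[OF adj_sym[OF v1(1)] _ a1(1) a2(1,4)] v2(1) jv1(1)
      c4[OF adj_sym[OF u1(1)] _ b1(1) b2(1,4)] u2(1) ju1(1) adj_sym
    by metis+
  have "distinct [a, b, c, a1, a2, b1, b2, c1, c2, w1, w2, v1, v2, u1, u2]"
  proof -
    note neq = far pairs ab11(2) ab12(2) ab21(2) ab22(2) ac11(2) ac12(2)
      ac21(2) ac22(2) bc11(2) bc12(2) bc21(2) bc22(2)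
      ab[THEN adj_neq] ac[THEN adj_neq] bc[THEN adj_neq] sym[THEN adj_neq]
    note ds = Na(2) Nb(2) Nc(2) Na1[THEN conjunct2] Na2[THEN conjunct2] Nb1[THEN conjunct2]
      Nb2[THEN conjunct2] Nc1[THEN conjunct2] Nc2[THEN conjunct2] Nw1[THEN conjunct2]
      Nw2[THEN conjunct2] Nv1[THEN conjunct2] Nv2[THEN conjunct2] Nu1[THEN conjunct2] Nu2[THEN conjunct2]
    show ?thesis
      using ds neq unfolding distinct.simps list.set insert_iff empty_iff by (simp add: neq neq[symmetric] eq_commute)
  qed
  then show ?thesis
    using Na(1) Nb(1) Nc(1) Na1 Na2 Nb1 Nb2 Nc1 Nc2 Nw1 Nw2 Nv1 Nv2 Nu1 Nu2
    by (intro H_recognition[of a b c a1 a2 b1 b2 c1 c2 w1 w2 v1 v2 u1 u2]) (simp_all add: insert_commute)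
qed

end

theorem theorem1p5:
  fixes G :: "'a sgraph"
  assumes "simple_graph G"
    and "locally_finite_graph G"
    and "connected_graph G"
    and "positively_LLY_curved G"
    and "graph_free (cycle_graph 4) G"
    and "min_degree G \<ge> 2"
  shows "isomorphic G (cycle_graph 3) \<or> isomorphic G (cycle_graph 5) \<or>
         isomorphic G T_graph \<or> isomorphic G H_graph \<or>
         (\<exists>k\<in>{2, 3}. isomorphic G (friendship_graph k))"
proof -
  interpret pos_curved_c4_free G
    using assms by unfold_locales
  show ?thesis
  proof (cases "\<exists>x y. adj x y \<and> N x \<inter> N y = {}")
    case True
    then show ?thesis using C5_case by blast
  next
    case False
    then have "\<exists>z. adj x z \<and> adj y z" if "adj x y" for x y
      using that by fastforce
    then interpret pos_curved_triangulated G
      by unfold_locales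
    show ?thesis
    proof (cases "\<forall>x\<in>verts G. card (N x) = 4")
      case True
      then show ?thesis using H_case by blast
    next
      case False
      then obtain x where x: "x \<in> verts G" "card (N x) \<noteq> 4" by blast
      \<comment> \<open>The perfect matching on the neighborhood has at most three edges, and two
        edges are excluded by the choice of \<open>x\<close>.\<close>
      have "card (N x) = 2 \<or> card (N x) = 6"
        using x(1)
      proof (cases rule: N_cases)
        case (2 p q)
        then show ?thesis using adj_neq[OF 2(2)] by simp
      next
        case (4 p q r s)
        then show ?thesis using x(2) by simp
      next
        case (6 p q r s t u)
        then show ?thesis by simp
      qed
      then show ?thesis using degree_2_case[OF x(1)] degree_6_case[OF x(1)] by blast
    qed
  qed
qed

end
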